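(* Let $\mathcal{D}=(G,\chi,a,\alpha)$ be a datum and let $\mathcal{H}=(H_{\mathcal{D}},\cdot,\mathbin{:})$ be a Hopf $q$-brace structure on $H_{\mathcal{D}}$ such that $x\cdot x\ne0$ and $x\mathbin{:}x\ne0$. Let $L:=\{h\in\mathrm{Soc}(G,\cdot,\mathbin{:}):\chi(h)=1\}$. Then $\mathrm{Soc}(\mathcal{H})=\mathds{k}[L]$.
   Context: $\mathds{k}$ is an algebraically closed field of characteristic zero. Sweedler notation is used. Multiplication has precedence over the binary operations $\cdot$ and $\mathbin{:}$, which have precedence over $+$ and $-$. Rank one pointed Hopf algebras. A datum $\mathcal{D}=(G,\chi,a,\alpha)$ consists of a finite group $G$, a character $\chi\colon G\to\mathds{k}^{\times}$, a central element $a\in G$ and $\alpha\in\mathds{k}$ such that, denoting by $n$ the order of $\chi(a)$, one has $n>1$ and ($\alpha(a^n-1)=0$ in $\mathds{k}[G]$ or $\chi^n=1$). $H_{\mathcal{D}}$ is the Hopf algebra generated as an algebra by $G$ and $x$, subject to the group relations of $G$, $x^n=\alpha(a^n-1)$ and $xg=\chi(g)gx$ for $g\in G$, with $\Delta(x)=x\otimes a+1\otimes x$, $\Delta(g)=g\otimes g$ (so $\epsilon(g)=1$, $\epsilon(x)=0$). It has $\mathds{k}$-basis $\{gx^m: g\in G,\ 0\le m<n\}$. Hopf $q$-braces. Let $X$ be a coalgebra and $p,d\colon X\otimes X\to X$ linear maps with $\epsilon\circ p=\epsilon\circ d=\epsilon\otimes\epsilon$; write $x\cdot y=p(x\otimes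 y)$, $x\mathbin{:}y=d(x\otimes y)$. $(X,\cdot,\mathbin{:})$ is a $q$-magma coalgebra if the map $X\otimes X^{\mathrm{cop}}\to X^{\mathrm{cop}}\otimes X$, $x\otimes y\mapsto y_{(1)}\mathbin{:}x_{(2)}\otimes x_{(1)}\cdot y_{(2)}$, is a coalgebra morphism. It is left regular if $x\otimes y\mapsto x\cdot y_{(1)}\otimes y_{(2)}$ is bijective on $X\otimes X$, right regular if $x\otimes y\mapsto x\mathbin{:}y_{(2)}\otimes y_{(1)}$ is bijective, and regular if it is both. A $q$-cycle coalgebra is a left regular $q$-magma coalgebra such that for all $u,v,w$: $(u\cdot v_{(1)})\cdot(w\mathbin{:}v_{(2)})=(u\cdot w_{(2)})\cdot(v\cdot w_{(1)})$, $(u\cdot v_{(1)})\mathbin{:}(w\cdot v_{(2)})=(u\mathbin{:}w_{(2)})\cdot(v\mathbin{:}w_{(1)})$, $(u\mathbin{:}v_{(1)})\mathbin{:}(w\mathbin{:}v_{(2)})=(u\mathbin{:}w_{(2)})\mathbin{:}(v\cdot w_{(1)})$. A Hopf $q$-brace is a Hopf algebra $H$ with a regular $q$-cycle coalgebra structure $(H,\cdot,\mathbin{:})$ such that $(H,\cdot)$ and $(H,\mathbin{:})$ are right $H^{\mathrm{op}}$-modules (i.e. $h\cdot 1=h$, $h\cdot kl=(h\cdot l)\cdot k$, and likewise for $\mathbin{:}$) and, for all $h,k,l\in H$, $hk\cdot l=(h\cdot(l_{(1)}\mathbin{:}k_{(2)}))(k_{(1)}\cdot l_{(2)})$ and $hk\mathbin{:}l=(h\mathbin{:}(l_{(1)}\cdot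 k_{(2)}))(k_{(1)}\mathbin{:}l_{(2)})$. Socle. For a Hopf $q$-brace $\mathcal{H}=(H,\cdot,\mathbin{:})$ with bijective antipode, $\mathrm{Soc}(\mathcal{H}):=\{u\in H: u_{(1)}\otimes v\cdot u_{(2)}\otimes u_{(3)}=u_{(1)}\otimes v\mathbin{:}u_{(2)}\otimes u_{(3)}=u_{(1)}\otimes v\otimes u_{(2)}\text{ for all }v\in H\}$. For the $q$-brace $(G,\cdot,\mathbin{:})$ obtained by restricting the operations to $G$, $\mathrm{Soc}(G,\cdot,\mathbin{:})=\{h\in G: k\cdot h=k\mathbin{:}h=k\text{ for all }k\in G\}$. Known facts: for a Hopf $q$-brace on $H_{\mathcal{D}}$ with $x\cdot x\ne0$ and $x\mathbin{:}x\ne0$, one has $n=2$, $\chi^2=1$, $a\cdot g=a\mathbin{:}g=a$ and $g\cdot a=g\mathbin{:}a=g$ for $g\in G$, and there is $\lambda_{10}\in\mathds{k}^\times$ such that for all $h,g\in G$: $hx\cdot g=\chi(g)(h\cdot g)x$, $hx\mathbin{:}g=\chi(g)(h\mathbin{:}g)x$, $h\cdot gx=h\mathbin{:}gx=0$, $hx\cdot gx=\lambda_{10}(h\cdot g)(1-a)$, $hx\mathbin{:}gx=-\lambda_{10}(h\mathbin{:}g)(1-a)$. *)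

theory Defs
  imports "HOL-Algebra.Algebraic_Closure_Type" "HOL-Library.Poly_Mapping"
begin

section \<open>Vector spaces and tensor products\<close>

text \<open>
  A vector space over \<open>'k\<close> is represented as the space \<open>'b \<Rightarrow>\<^sub>0 'k\<close> of finitely supported
  functions on an arbitrary type \<open>'b\<close>, that is, as a vector space with a named basis indexed by
  \<open>'b\<close>; every non-zero space arises in this way. The tensor product of \<open>'b \<Rightarrow>\<^sub>0 'k\<close> and
  \<open>'c \<Rightarrow>\<^sub>0 'k\<close> is then \<open>'b \<times> 'c \<Rightarrow>\<^sub>0 'k\<close>. The basis plays no other role: none of the structures
  below refers to it.
\<close>

definition smul :: "'k \<Rightarrow> ('b \<Rightarrow>\<^sub>0 'k::field) \<Rightarrow> ('b \<Rightarrow>\<^sub>0 'k)" (infixr "*\<^sub>k" 75)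
  where "c *\<^sub>k v = Poly_Mapping.map ((*) c) v"

lemma lookup_smul [simp]: "Poly_Mapping.lookup (c *\<^sub>k v) b = c * Poly_Mapping.lookup v b"
  by (simp add: smul_def Poly_Mapping.map.rep_eq when_def)

global_interpretation pm: vector_space "smul :: 'k \<Rightarrow> ('b \<Rightarrow>\<^sub>0 'k::field) \<Rightarrow> ('b \<Rightarrow>\<^sub>0 'k)"
  by unfold_locales (auto intro!: poly_mapping_eqI simp: lookup_add algebra_simps)

abbreviation lin :: "(('b \<Rightarrow>\<^sub>0 'k::field) \<Rightarrow> ('c \<Rightarrow>\<^sub>0 'k)) \<Rightarrow> bool"
  where "lin \<equiv> Vector_Spaces.linear smul smul"

abbreviation lin_form :: "(('b \<Rightarrow>\<^sub>0 'k::field) \<Rightarrow> 'k) \<Rightarrow> bool"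
  where "lin_form \<equiv> Vector_Spaces.linear smul (*)"

definition bilin :: "(('b \<Rightarrow>\<^sub>0 'k::field) \<Rightarrow> ('c \<Rightarrow>\<^sub>0 'k) \<Rightarrow> ('d \<Rightarrow>\<^sub>0 'k)) \<Rightarrow> bool"
  where "bilin F \<longleftrightarrow> (\<forall>u. lin (F u)) \<and> (\<forall>v. lin (\<lambda>u. F u v))"

definition lin_ext :: "('b \<Rightarrow> ('c \<Rightarrow>\<^sub>0 'k)) \<Rightarrow> ('b \<Rightarrow>\<^sub>0 'k::field) \<Rightarrow> ('c \<Rightarrow>\<^sub>0 'k)"
  where "lin_ext F v = (\<Sum>b\<in>Poly_Mapping.keys v. Poly_Mapping.lookup v b *\<^sub>k F b)"

definition tensor :: "('b \<Rightarrow>\<^sub>0 'k::field) \<Rightarrow> ('c \<Rightarrow>\<^sub>0 'k) \<Rightarrow> ('b \<times> 'c \<Rightarrow>\<^sub>0 'k)" (infixr "\<otimes>\<^sub>k" 67)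
  where "u \<otimes>\<^sub>k v = lin_ext (\<lambda>b. lin_ext (\<lambda>c. Poly_Mapping.single (b, c) 1) v) u"

text \<open>
  For bilinear \<open>F\<close>, \<open>on_tensor F\<close> is the linear map on the tensor product that sends \<open>u \<otimes>\<^sub>k v\<close>
  to \<open>F u v\<close> (lemma \<open>on_tensor_tensor\<close>). It is meaningful for bilinear \<open>F\<close> only.
\<close>

definition on_tensor ::
    "(('b \<Rightarrow>\<^sub>0 'k::field) \<Rightarrow> ('c \<Rightarrow>\<^sub>0 'k) \<Rightarrow> ('d \<Rightarrow>\<^sub>0 'k)) \<Rightarrow> ('b \<times> 'c \<Rightarrow>\<^sub>0 'k) \<Rightarrow> ('d \<Rightarrow>\<^sub>0 'k)"
  where "on_tensor F = lin_ext (\<lambda>(b, c). F (Poly_Mapping.single b 1) (Poly_Mapping.single c 1))"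

lemma lin_ext_superset:
  assumes "finite A" "Poly_Mapping.keys v \<subseteq> A"
  shows "lin_ext F v = (\<Sum>b\<in>A. Poly_Mapping.lookup v b *\<^sub>k F b)"
  unfolding lin_ext_def
  by (rule sum.mono_neutral_left) (use assms in \<open>auto simp: in_keys_iff\<close>)

lemma lin_lin_ext: "lin (lin_ext F)"
proof -
  have "lin_ext F (u + v) = lin_ext F u + lin_ext F v" for u v
  proof -
    have "Poly_Mapping.keys (u + v) \<subseteq> Poly_Mapping.keys u \<union> Poly_Mapping.keys v" by (rule Poly_Mapping.keys_add)
    then show ?thesis
      by (subst (1 2 3) lin_ext_superset[of "Poly_Mapping.keys u \<union> Poly_Mapping.keys v"])
        (auto simp: lookup_add pm.scale_left_distrib sum.distrib)
  qed
  moreover have "lin_ext F (c *\<^sub>k v) = c *\<^sub>k lin_ext F v" for c v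
  proof -
    have "Poly_Mapping.keys (c *\<^sub>k v) \<subseteq> Poly_Mapping.keys v" by (auto simp: in_keys_iff)
    then show ?thesis
      by (subst (1 2) lin_ext_superset[of "Poly_Mapping.keys v"]) (auto simp: pm.scale_sum_right)
  qed
  ultimately show ?thesis
    by (intro Vector_Spaces.linear.intro module_hom.intro module_hom_axioms.intro)
      (auto intro: pm.vector_space_axioms pm.module_axioms)
qed

lemma lin_ext_single [simp]: "lin_ext F (Poly_Mapping.single b 1) = F b"
  by (subst lin_ext_superset[of "{b}"]) auto

lemma sum_singles:
  fixes v :: "'b \<Rightarrow>\<^sub>0 'k::field"
  shows "v = (\<Sum>b\<in>Poly_Mapping.keys v. Poly_Mapping.lookup v b *\<^sub>k Poly_Mapping.single b 1)"
    (is "v = ?s")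
proof (rule poly_mapping_eqI)
  fix c
  have "(\<Sum>b\<in>Poly_Mapping.keys v. Poly_Mapping.lookup v b * (1 when b = c)) =
      (\<Sum>b\<in>Poly_Mapping.keys v. if b = c then Poly_Mapping.lookup v c else 0)"
    by (rule sum.cong) (auto simp: when_def)
  then show "Poly_Mapping.lookup v c = Poly_Mapping.lookup ?s c"
    by (auto simp: lookup_sum lookup_single in_keys_iff)
qed

lemma lin_eq_lin_ext:
  assumes "lin f"
  shows "f v = lin_ext (\<lambda>b. f (Poly_Mapping.single b 1)) v"
proof -
  interpret f: Vector_Spaces.linear smul smul f by (rule assms)
  show ?thesis
    by (subst sum_singles[of v]) (simp add: f.sum f.scale lin_ext_def)
qed

lemma on_tensor_tensor:
  assumes "bilin F"
  shows "on_tensor F (u \<otimes>\<^sub>k v) = F u v"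
proof -
  interpret L: Vector_Spaces.linear smul smul "on_tensor F"
    unfolding on_tensor_def by (rule lin_lin_ext)
  have 1: "lin (F u')" and 2: "lin (\<lambda>u. F u v')" for u' v'
    using assms by (auto simp: bilin_def)
  have "on_tensor F (u \<otimes>\<^sub>k v) =
      lin_ext (\<lambda>b. lin_ext (\<lambda>c. F (Poly_Mapping.single b 1) (Poly_Mapping.single c 1)) v) u"
    by (simp add: tensor_def lin_ext_def L.sum L.scale) (simp add: on_tensor_def)
  also have "\<dots> = lin_ext (\<lambda>b. F (Poly_Mapping.single b 1) v) u"
    by (simp only: lin_eq_lin_ext[OF 1, of _ v, symmetric])
  also have "\<dots> = F u v"
    by (rule lin_eq_lin_ext[OF 2, symmetric])
  finally show ?thesis .
qed

text \<open>
  Sweedler notation: \<open>sw \<Delta> u (\<lambda>u1 u2. E u1 u2)\<close> stands for the expression written \<open>E\<close> with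
  \<open>u1\<close>, \<open>u2\<close> for the two components of \<open>\<Delta> u\<close>.
\<close>

definition sw :: "(('b \<Rightarrow>\<^sub>0 'k::field) \<Rightarrow> ('c \<times> 'd \<Rightarrow>\<^sub>0 'k)) \<Rightarrow> ('b \<Rightarrow>\<^sub>0 'k) \<Rightarrow>
    (('c \<Rightarrow>\<^sub>0 'k) \<Rightarrow> ('d \<Rightarrow>\<^sub>0 'k) \<Rightarrow> ('e \<Rightarrow>\<^sub>0 'k)) \<Rightarrow> ('e \<Rightarrow>\<^sub>0 'k)"
  where "sw \<Delta> u E = on_tensor E (\<Delta> u)"


section \<open>Coalgebras and Hopf algebras\<close>

locale coalgebra =
  fixes \<Delta> :: "('b \<Rightarrow>\<^sub>0 'k::field) \<Rightarrow> ('b \<times> 'b \<Rightarrow>\<^sub>0 'k)"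
    and \<epsilon> :: "('b \<Rightarrow>\<^sub>0 'k) \<Rightarrow> 'k"
  assumes lin_comult: "lin \<Delta>"
    and lin_counit: "lin_form \<epsilon>"
    and coassoc: "sw \<Delta> u (\<lambda>u1 u2. sw \<Delta> u1 (\<lambda>u11 u12. u11 \<otimes>\<^sub>k u12 \<otimes>\<^sub>k u2)) =
                  sw \<Delta> u (\<lambda>u1 u2. u1 \<otimes>\<^sub>k \<Delta> u2)"
    and counit_left: "sw \<Delta> u (\<lambda>u1 u2. \<epsilon> u1 *\<^sub>k u2) = u"
    and counit_right: "sw \<Delta> u (\<lambda>u1 u2. \<epsilon> u2 *\<^sub>k u1) = u"

definition comult_cop ::
    "(('b \<Rightarrow>\<^sub>0 'k::field) \<Rightarrow> ('b \<times> 'b \<Rightarrow>\<^sub>0 'k)) \<Rightarrow> ('b \<Rightarrow>\<^sub>0 'k) \<Rightarrow> ('b \<times> 'b \<Rightarrow>\<^sub>0 'k)"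
  where "comult_cop \<Delta> u = sw \<Delta> u (\<lambda>u1 u2. u2 \<otimes>\<^sub>k u1)"

definition comult_tensor ::
    "(('b \<Rightarrow>\<^sub>0 'k::field) \<Rightarrow> ('b \<times> 'b \<Rightarrow>\<^sub>0 'k)) \<Rightarrow> (('c \<Rightarrow>\<^sub>0 'k) \<Rightarrow> ('c \<times> 'c \<Rightarrow>\<^sub>0 'k)) \<Rightarrow>
     ('b \<times> 'c \<Rightarrow>\<^sub>0 'k) \<Rightarrow> (('b \<times> 'c) \<times> ('b \<times> 'c) \<Rightarrow>\<^sub>0 'k)"
  where "comult_tensor \<Delta> \<Delta>' = on_tensor (\<lambda>u v.
    sw \<Delta> u (\<lambda>u1 u2. sw \<Delta>' v (\<lambda>v1 v2. (u1 \<otimes>\<^sub>k v1) \<otimes>\<^sub>k (u2 \<otimes>\<^sub>k v2))))"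

definition counit_tensor ::
    "(('b \<Rightarrow>\<^sub>0 'k::field) \<Rightarrow> 'k) \<Rightarrow> (('c \<Rightarrow>\<^sub>0 'k) \<Rightarrow> 'k) \<Rightarrow> ('b \<times> 'c \<Rightarrow>\<^sub>0 'k) \<Rightarrow> 'k"
  where "counit_tensor \<epsilon> \<epsilon>' t = (\<Sum>(b, c)\<in>Poly_Mapping.keys t.
    Poly_Mapping.lookup t (b, c) * (\<epsilon> (Poly_Mapping.single b 1) * \<epsilon>' (Poly_Mapping.single c 1)))"

definition coalgebra_morphism ::
    "(('b \<Rightarrow>\<^sub>0 'k::field) \<Rightarrow> ('b \<times> 'b \<Rightarrow>\<^sub>0 'k)) \<Rightarrow> (('b \<Rightarrow>\<^sub>0 'k) \<Rightarrow> 'k) \<Rightarrow>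
     (('c \<Rightarrow>\<^sub>0 'k) \<Rightarrow> ('c \<times> 'c \<Rightarrow>\<^sub>0 'k)) \<Rightarrow> (('c \<Rightarrow>\<^sub>0 'k) \<Rightarrow> 'k) \<Rightarrow>
     (('b \<Rightarrow>\<^sub>0 'k) \<Rightarrow> ('c \<Rightarrow>\<^sub>0 'k)) \<Rightarrow> bool"
  where "coalgebra_morphism \<Delta> \<epsilon> \<Delta>' \<epsilon>' f \<longleftrightarrow>
    lin f \<and> (\<forall>u. \<Delta>' (f u) = sw \<Delta> u (\<lambda>u1 u2. f u1 \<otimes>\<^sub>k f u2)) \<and> (\<forall>u. \<epsilon>' (f u) = \<epsilon> u)"

locale unital_algebra =
  fixes mul :: "('b \<Rightarrow>\<^sub>0 'k::field) \<Rightarrow> ('b \<Rightarrow>\<^sub>0 'k) \<Rightarrow> ('b \<Rightarrow>\<^sub>0 'k)" (infixl "\<star>" 72)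
    and unit :: "'b \<Rightarrow>\<^sub>0 'k"
  assumes bilin_mul: "bilin (\<star>)"
    and mul_assoc: "(u \<star> v) \<star> w = u \<star> (v \<star> w)"
    and unit_left: "unit \<star> u = u"
    and unit_right: "u \<star> unit = u"

locale hopf_algebra = unital_algebra mul unit + coalgebra \<Delta> \<epsilon>
  for mul :: "('b \<Rightarrow>\<^sub>0 'k::field) \<Rightarrow> ('b \<Rightarrow>\<^sub>0 'k) \<Rightarrow> ('b \<Rightarrow>\<^sub>0 'k)" (infixl "\<star>" 72)
    and unit :: "'b \<Rightarrow>\<^sub>0 'k"
    and \<Delta> :: "('b \<Rightarrow>\<^sub>0 'k) \<Rightarrow> ('b \<times> 'b \<Rightarrow>\<^sub>0 'k)"
    and \<epsilon> :: "('b \<Rightarrow>\<^sub>0 'k) \<Rightarrow> 'k" +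
  fixes S :: "('b \<Rightarrow>\<^sub>0 'k) \<Rightarrow> ('b \<Rightarrow>\<^sub>0 'k)"
  assumes comult_mul: "\<Delta> (u \<star> v) =
      sw \<Delta> u (\<lambda>u1 u2. sw \<Delta> v (\<lambda>v1 v2. (u1 \<star> v1) \<otimes>\<^sub>k (u2 \<star> v2)))"
    and comult_unit: "\<Delta> unit = unit \<otimes>\<^sub>k unit"
    and counit_mul: "\<epsilon> (u \<star> v) = \<epsilon> u * \<epsilon> v"
    and counit_unit: "\<epsilon> unit = 1"
    and lin_antipode: "lin S"
    and antipode_left: "sw \<Delta> u (\<lambda>u1 u2. S u1 \<star> u2) = \<epsilon> u *\<^sub>k unit"
    and antipode_right: "sw \<Delta> u (\<lambda>u1 u2. u1 \<star> S u2) = \<epsilon> u *\<^sub>k unit"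


section \<open>Hopf q-braces\<close>

text \<open>The operation written with a colon in the literature is denoted \<open>\<Ztypecolon>\<close>.\<close>

locale q_magma_coalgebra = coalgebra \<Delta> \<epsilon>
  for \<Delta> :: "('b \<Rightarrow>\<^sub>0 'k::field) \<Rightarrow> ('b \<times> 'b \<Rightarrow>\<^sub>0 'k)"
    and \<epsilon> :: "('b \<Rightarrow>\<^sub>0 'k) \<Rightarrow> 'k" +
  fixes dot :: "('b \<Rightarrow>\<^sub>0 'k) \<Rightarrow> ('b \<Rightarrow>\<^sub>0 'k) \<Rightarrow> ('b \<Rightarrow>\<^sub>0 'k)" (infixl "\<cdot>" 69)
    and colon :: "('b \<Rightarrow>\<^sub>0 'k) \<Rightarrow> ('b \<Rightarrow>\<^sub>0 'k) \<Rightarrow> ('b \<Rightarrow>\<^sub>0 'k)" (infixl "\<Ztypecolon>" 69)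
  assumes bilin_dot: "bilin (\<cdot>)"
    and bilin_colon: "bilin (\<Ztypecolon>)"
    and counit_dot: "\<epsilon> (u \<cdot> v) = \<epsilon> u * \<epsilon> v"
    and counit_colon: "\<epsilon> (u \<Ztypecolon> v) = \<epsilon> u * \<epsilon> v"
    and q_magma_morphism:
      "coalgebra_morphism
        (comult_tensor \<Delta> (comult_cop \<Delta>)) (counit_tensor \<epsilon> \<epsilon>)
        (comult_tensor (comult_cop \<Delta>) \<Delta>) (counit_tensor \<epsilon> \<epsilon>)
        (on_tensor (\<lambda>u v. sw \<Delta> u (\<lambda>u1 u2. sw \<Delta> v (\<lambda>v1 v2. (v1 \<Ztypecolon> u2) \<otimes>\<^sub>k (u1 \<cdot> v2)))))"
begin

definition left_regular :: bool
  where "left_regular \<longleftrightarrow> bij (on_tensor (\<lambda>u v. sw \<Delta> v (\<lambda>v1 v2. (u \<cdot> v1) \<otimes>\<^sub>k v2)))"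

definition right_regular :: bool
  where "right_regular \<longleftrightarrow> bij (on_tensor (\<lambda>u v. sw \<Delta> v (\<lambda>v1 v2. (u \<Ztypecolon> v2) \<otimes>\<^sub>k v1)))"

definition regular :: bool
  where "regular \<longleftrightarrow> left_regular \<and> right_regular"

end

locale q_cycle_coalgebra = q_magma_coalgebra +
  assumes left_regular: left_regular
    and q_cycle_1:
      "sw \<Delta> v (\<lambda>v1 v2. (u \<cdot> v1) \<cdot> (w \<Ztypecolon> v2)) = sw \<Delta> w (\<lambda>w1 w2. (u \<cdot> w2) \<cdot> (v \<cdot> w1))"
    and q_cycle_2:
      "sw \<Delta> v (\<lambda>v1 v2. (u \<cdot> v1) \<Ztypecolon> (w \<cdot> v2)) = sw \<Delta> w (\<lambda>w1 w2. (u \<Ztypecolon> w2) \<cdot> (v \<Ztypecolon> w1))"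
    and q_cycle_3:
      "sw \<Delta> v (\<lambda>v1 v2. (u \<Ztypecolon> v1) \<Ztypecolon> (w \<Ztypecolon> v2)) = sw \<Delta> w (\<lambda>w1 w2. (u \<Ztypecolon> w2) \<Ztypecolon> (v \<cdot> w1))"

locale hopf_q_brace = hopf_algebra mul unit \<Delta> \<epsilon> S + q_cycle_coalgebra \<Delta> \<epsilon> dot colon
  for mul :: "('b \<Rightarrow>\<^sub>0 'k::field) \<Rightarrow> ('b \<Rightarrow>\<^sub>0 'k) \<Rightarrow> ('b \<Rightarrow>\<^sub>0 'k)" (infixl "\<star>" 72)
    and unit :: "'b \<Rightarrow>\<^sub>0 'k"
    and \<Delta> :: "('b \<Rightarrow>\<^sub>0 'k) \<Rightarrow> ('b \<times> 'b \<Rightarrow>\<^sub>0 'k)"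
    and \<epsilon> :: "('b \<Rightarrow>\<^sub>0 'k) \<Rightarrow> 'k"
    and S :: "('b \<Rightarrow>\<^sub>0 'k) \<Rightarrow> ('b \<Rightarrow>\<^sub>0 'k)"
    and dot :: "('b \<Rightarrow>\<^sub>0 'k) \<Rightarrow> ('b \<Rightarrow>\<^sub>0 'k) \<Rightarrow> ('b \<Rightarrow>\<^sub>0 'k)" (infixl "\<cdot>" 69)
    and colon :: "('b \<Rightarrow>\<^sub>0 'k) \<Rightarrow> ('b \<Rightarrow>\<^sub>0 'k) \<Rightarrow> ('b \<Rightarrow>\<^sub>0 'k)" (infixl "\<Ztypecolon>" 69) +
  assumes regular: regular
    and dot_unit: "h \<cdot> unit = h"
    and dot_mul: "h \<cdot> k \<star> l = (h \<cdot> l) \<cdot> k"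
    and colon_unit: "h \<Ztypecolon> unit = h"
    and colon_mul: "h \<Ztypecolon> k \<star> l = (h \<Ztypecolon> l) \<Ztypecolon> k"
    and mul_dot: "h \<star> k \<cdot> l =
      sw \<Delta> l (\<lambda>l1 l2. sw \<Delta> k (\<lambda>k1 k2. (h \<cdot> (l1 \<Ztypecolon> k2)) \<star> (k1 \<cdot> l2)))"
    and mul_colon: "h \<star> k \<Ztypecolon> l =
      sw \<Delta> l (\<lambda>l1 l2. sw \<Delta> k (\<lambda>k1 k2. (h \<Ztypecolon> (l1 \<cdot> k2)) \<star> (k1 \<Ztypecolon> l2)))"

definition hopf_socle ::
    "(('b \<Rightarrow>\<^sub>0 'k::field) \<Rightarrow> ('b \<times> 'b \<Rightarrow>\<^sub>0 'k)) \<Rightarrow>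
     (('b \<Rightarrow>\<^sub>0 'k) \<Rightarrow> ('b \<Rightarrow>\<^sub>0 'k) \<Rightarrow> ('b \<Rightarrow>\<^sub>0 'k)) \<Rightarrow>
     (('b \<Rightarrow>\<^sub>0 'k) \<Rightarrow> ('b \<Rightarrow>\<^sub>0 'k) \<Rightarrow> ('b \<Rightarrow>\<^sub>0 'k)) \<Rightarrow> ('b \<Rightarrow>\<^sub>0 'k) set"
  where "hopf_socle \<Delta> dot colon = {u. \<forall>v.
    sw \<Delta> u (\<lambda>u1 u'. sw \<Delta> u' (\<lambda>u2 u3. u1 \<otimes>\<^sub>k dot v u2 \<otimes>\<^sub>k u3)) = sw \<Delta> u (\<lambda>u1 u2. u1 \<otimes>\<^sub>k v \<otimes>\<^sub>k u2) \<and>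
    sw \<Delta> u (\<lambda>u1 u'. sw \<Delta> u' (\<lambda>u2 u3. u1 \<otimes>\<^sub>k colon v u2 \<otimes>\<^sub>k u3)) = sw \<Delta> u (\<lambda>u1 u2. u1 \<otimes>\<^sub>k v \<otimes>\<^sub>k u2)}"

text \<open>Socle of the operations restricted to a group embedded in the Hopf algebra by \<open>\<iota>\<close>.\<close>

definition group_socle ::
    "('g, 'r) monoid_scheme \<Rightarrow> ('g \<Rightarrow> ('b \<Rightarrow>\<^sub>0 'k::field)) \<Rightarrow>
     (('b \<Rightarrow>\<^sub>0 'k) \<Rightarrow> ('b \<Rightarrow>\<^sub>0 'k) \<Rightarrow> ('b \<Rightarrow>\<^sub>0 'k)) \<Rightarrow>
     (('b \<Rightarrow>\<^sub>0 'k) \<Rightarrow> ('b \<Rightarrow>\<^sub>0 'k) \<Rightarrow> ('b \<Rightarrow>\<^sub>0 'k)) \<Rightarrow> 'g set"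
  where "group_socle G \<iota> dot colon = {h \<in> carrier G.
    \<forall>k\<in>carrier G. dot (\<iota> k) (\<iota> h) = \<iota> k \<and> colon (\<iota> k) (\<iota> h) = \<iota> k}"


section \<open>Free algebras and presentations\<close>

text \<open>The free algebra on a set \<open>A\<close> of letters has the words over \<open>A\<close> as a basis.\<close>

definition free_alg :: "'s set \<Rightarrow> ('s list \<Rightarrow>\<^sub>0 'k::field) set"
  where "free_alg A = {f. Poly_Mapping.keys f \<subseteq> lists A}"

definition word :: "'s list \<Rightarrow> ('s list \<Rightarrow>\<^sub>0 'k::field)"
  where "word w = Poly_Mapping.single w 1"

definition free_mul ::
    "('s list \<Rightarrow>\<^sub>0 'k::field) \<Rightarrow> ('s list \<Rightarrow>\<^sub>0 'k) \<Rightarrow> ('s list \<Rightarrow>\<^sub>0 'k)"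
  where "free_mul f g = lin_ext (\<lambda>v. lin_ext (\<lambda>w. word (v @ w)) g) f"

definition free_ideal :: "'s set \<Rightarrow> ('s list \<Rightarrow>\<^sub>0 'k::field) set \<Rightarrow> ('s list \<Rightarrow>\<^sub>0 'k) set"
  where "free_ideal A R =
    pm.span {free_mul f (free_mul r g) | f r g. f \<in> free_alg A \<and> r \<in> R \<and> g \<in> free_alg A}"

definition free_eval ::
    "(('b \<Rightarrow>\<^sub>0 'k::field) \<Rightarrow> ('b \<Rightarrow>\<^sub>0 'k) \<Rightarrow> ('b \<Rightarrow>\<^sub>0 'k)) \<Rightarrow> ('b \<Rightarrow>\<^sub>0 'k) \<Rightarrow>
     ('s \<Rightarrow> ('b \<Rightarrow>\<^sub>0 'k)) \<Rightarrow> ('s list \<Rightarrow>\<^sub>0 'k) \<Rightarrow> ('b \<Rightarrow>\<^sub>0 'k)"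
  where "free_eval mul unit \<phi> = lin_ext (\<lambda>w. foldr (\<lambda>s. mul (\<phi> s)) w unit)"

definition presented_by ::
    "(('b \<Rightarrow>\<^sub>0 'k::field) \<Rightarrow> ('b \<Rightarrow>\<^sub>0 'k) \<Rightarrow> ('b \<Rightarrow>\<^sub>0 'k)) \<Rightarrow> ('b \<Rightarrow>\<^sub>0 'k) \<Rightarrow>
     ('s \<Rightarrow> ('b \<Rightarrow>\<^sub>0 'k)) \<Rightarrow> 's set \<Rightarrow> ('s list \<Rightarrow>\<^sub>0 'k) set \<Rightarrow> bool"
  where "presented_by mul unit \<phi> A R \<longleftrightarrow>
    free_eval mul unit \<phi> ` free_alg A = UNIV \<and>
    {f \<in> free_alg A. free_eval mul unit \<phi> f = 0} = free_ideal A R"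


section \<open>Rank one pointed Hopf algebras\<close>

abbreviation units_group :: "'k::field monoid"
  where "units_group \<equiv> mult_of ring_of_type_algebra"

definition char_order :: "('g \<Rightarrow> 'k::field) \<Rightarrow> 'g \<Rightarrow> nat"
  where "char_order \<chi> a = group.ord units_group (\<chi> a)"

text \<open>The group algebra of \<open>G\<close> is the space spanned by \<open>carrier G\<close> in \<open>'g \<Rightarrow>\<^sub>0 'k\<close>.\<close>

locale rank_one_datum = group G for G :: "('g, 'r) monoid_scheme" (structure) +
  fixes \<chi> :: "'g \<Rightarrow> 'k::field" and a :: 'g and \<alpha> :: 'k
  assumes finite_carrier: "finite (carrier G)"
    and character: "\<chi> \<in> hom G units_group"
    and a_closed: "a \<in> carrier G"
    and a_central: "\<forall>g\<in>carrier G. a \<otimes> g = g \<otimes> a"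
    and order_gt_1: "char_order \<chi> a > 1"
    and compat:
      "\<alpha> *\<^sub>k (Poly_Mapping.single (a [^] char_order \<chi> a) 1 - Poly_Mapping.single \<one> 1) = 0 \<or>
       (\<forall>g\<in>carrier G. \<chi> g ^ char_order \<chi> a = 1)"

datatype 'g letter = Grp 'g | Var

definition rank_one_letters :: "('g, 'r) monoid_scheme \<Rightarrow> 'g letter set"
  where "rank_one_letters G = Grp ` carrier G \<union> {Var}"

definition rank_one_relations ::
    "('g, 'r) monoid_scheme \<Rightarrow> ('g \<Rightarrow> 'k::field) \<Rightarrow> 'g \<Rightarrow> 'k \<Rightarrow> ('g letter list \<Rightarrow>\<^sub>0 'k) set"
  where "rank_one_relations G \<chi> a \<alpha> =
    {word [Grp g, Grp h] - word [Grp (g \<otimes>\<^bsub>G\<^esub> h)] | g h. g \<in> carrier G \<and> h \<in> carrier G} \<union>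
    {word [Grp \<one>\<^bsub>G\<^esub>] - word []} \<union>
    {word (replicate (char_order \<chi> a) Var) -
       \<alpha> *\<^sub>k (word (replicate (char_order \<chi> a) (Grp a)) - word [])} \<union>
    {word [Var, Grp g] - \<chi> g *\<^sub>k word [Grp g, Var] | g. g \<in> carrier G}"

text \<open>
  The following says that the given Hopf algebra, with the images \<open>\<iota> g\<close> and \<open>x\<close> of the
  generators, is the rank one Hopf algebra of the datum.
\<close>

locale rank_one_hopf_algebra = rank_one_datum G \<chi> a \<alpha> + hopf_algebra mul unit \<Delta> \<epsilon> S
  for G :: "('g, 'r) monoid_scheme" (structure)
    and \<chi> :: "'g \<Rightarrow> 'k::field" and a :: 'g and \<alpha> :: 'k
    and mul :: "('b \<Rightarrow>\<^sub>0 'k) \<Rightarrow> ('b \<Rightarrow>\<^sub>0 'k) \<Rightarrow> ('b \<Rightarrow>\<^sub>0 'k)" (infixl "\<star>" 72)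
    and unit :: "'b \<Rightarrow>\<^sub>0 'k"
    and \<Delta> :: "('b \<Rightarrow>\<^sub>0 'k) \<Rightarrow> ('b \<times> 'b \<Rightarrow>\<^sub>0 'k)"
    and \<epsilon> :: "('b \<Rightarrow>\<^sub>0 'k) \<Rightarrow> 'k"
    and S :: "('b \<Rightarrow>\<^sub>0 'k) \<Rightarrow> ('b \<Rightarrow>\<^sub>0 'k)" +
  fixes \<iota> :: "'g \<Rightarrow> ('b \<Rightarrow>\<^sub>0 'k)" and x :: "'b \<Rightarrow>\<^sub>0 'k"
  assumes presentation:
      "presented_by (\<star>) unit (case_letter \<iota> x) (rank_one_letters G) (rank_one_relations G \<chi> a \<alpha>)"
    and comult_group: "\<forall>g\<in>carrier G. \<Delta> (\<iota> g) = \<iota> g \<otimes>\<^sub>k \<iota> g"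
    and comult_x: "\<Delta> x = x \<otimes>\<^sub>k \<iota> a + unit \<otimes>\<^sub>k x"

end

theory Submission
  imports Defs
begin

text \<open>
  Write \<open>n\<close> for the order of \<open>\<chi> a\<close>. Everything rests on how a group element can act on \<open>x\<close> and on
  the coefficients of an element \<open>u\<close> of \<open>H\<close> in the basis \<open>g x\<^sup>m\<close>, \<open>m < n\<close>.

  The morphism axiom of a q-magma coalgebra says that both operations multiply coproducts,
  \<open>\<Delta> (u \<cdot> v) = u\<^sub>1 \<cdot> v\<^sub>2 \<otimes> u\<^sub>2 \<cdot> v\<^sub>1\<close>, and that \<open>v\<^sub>1 : u\<^sub>2 \<otimes> u\<^sub>1 \<cdot> v\<^sub>2 = v\<^sub>2 : u\<^sub>1 \<otimes> u\<^sub>2 \<cdot> v\<^sub>1\<close>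
  (\<open>comult_dot\<close>, \<open>comult_colon\<close>, \<open>dot_colon_compat\<close>). So the operations send group-like elements to
  group-like elements, which are those of \<open>G\<close> (\<open>grouplike_imp_iota\<close>), and \<open>x \<cdot> g\<close> is
  skew-primitive, hence by \<open>skew_primitive\<close> of the form \<open>c\<^sub>g x + d\<^sub>g (1 - a)\<close>. The relation
  \<open>x g = \<chi>(g) g x\<close> together with \<open>x \<cdot> x \<noteq> 0\<close> gives \<open>c\<^sub>g = \<chi>(g)\<close> and \<open>x \<cdot> x \<in> k (1 - a)\<close>, and likewise
  for the colon. Evaluating the compatibility of the two operations at \<open>(x, x)\<close> now yields
  \<open>\<chi>(a)\<^sup>2 = 1\<close>, so \<open>n = 2\<close>, and \<open>d\<^sub>a = 0\<close>; as \<open>a\<close> is central, all \<open>d\<^sub>g\<close> vanish. Thus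
  \<open>x \<cdot> g = x : g = \<chi>(g) x\<close>.

  If \<open>h\<close> lies in the socle of \<open>G\<close> and \<open>\<chi>(h) = 1\<close>, the q-cycle identities evaluated at \<open>x\<close> show
  \<open>\<chi>(h : k) = \<chi>(h \<cdot> k) = 1\<close>. Hence \<open>x k \<cdot> h = (x \<cdot> (h : k)) (k \<cdot> h) = x k\<close>, so \<open>h\<close> acts trivially on
  all of \<open>H\<close> and \<open>k[L]\<close> is contained in the socle (\<open>trivial_on_group_imp_trivial\<close>).

  Conversely let \<open>u\<close> be in the socle, with coefficients \<open>U\<close> at \<open>g\<close> and \<open>W\<close> at \<open>g x\<close>. Reading off the
  coefficient of \<open>g\<close> in the first tensor factor of the socle condition leaves the condition
  \<open>v \<cdot> p\<^sub>1 \<otimes> p\<^sub>2 = v \<otimes> p\<close> for \<open>p = U g + W g x\<close>. Its component at \<open>g a\<close> in the second factor is \<open>W (v \<cdot> g x) = 0\<close>, which for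
  \<open>v = x\<close> forces \<open>W = 0\<close> because \<open>x \<cdot> x \<noteq> 0\<close>; its component at \<open>g\<close> is \<open>U (v \<cdot> g) = U v\<close>, so that
  \<open>U \<noteq> 0\<close> implies \<open>g \<in> L\<close> (\<open>trivial_action_support\<close>).
\<close>

section \<open>Linear maps on tensor products\<close>

lemma lin_iff:
  "lin f \<longleftrightarrow> (\<forall>u v. f (u + v) = f u + f v) \<and> (\<forall>c u. f (c *\<^sub>k u) = c *\<^sub>k f u)"
  by (auto simp: Vector_Spaces.linear_iff pm.vector_space_axioms)

lemma lin_form_iff:
  fixes f :: "('a \<Rightarrow>\<^sub>0 'b::field) \<Rightarrow> 'b"
  shows "lin_form f \<longleftrightarrow> (\<forall>u v. f (u + v) = f u + f v) \<and> (\<forall>c u. f (c *\<^sub>k u) = c * f u)"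
proof -
  have "vector_space ((*) :: 'b \<Rightarrow> 'b \<Rightarrow> 'b::field)"
    by unfold_locales (auto simp: algebra_simps)
  then show ?thesis
    by (auto simp: Vector_Spaces.linear_iff pm.vector_space_axioms)
qed

lemma linD:
  assumes "lin f"
  shows "f (u + v) = f u + f v" "f (c *\<^sub>k u) = c *\<^sub>k f u" "f 0 = 0" "f (- u) = - f u"
    "f (u - v) = f u - f v" "f (sum g A) = (\<Sum>i\<in>A. f (g i))"
proof -
  interpret f: Vector_Spaces.linear smul smul f by (rule assms)
  show "f (u + v) = f u + f v" "f (c *\<^sub>k u) = c *\<^sub>k f u" "f 0 = 0" "f (- u) = - f u"
    "f (u - v) = f u - f v" "f (sum g A) = (\<Sum>i\<in>A. f (g i))"
    by (auto simp: f.add f.scale f.neg f.diff f.sum)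
qed

lemma lin_formD:
  assumes "lin_form f"
  shows "f (u + v) = f u + f v" "f (c *\<^sub>k u) = c * f u" "f 0 = 0"
    "f (u - v) = f u - f v" "f (sum g A) = (\<Sum>i\<in>A. f (g i))"
proof -
  interpret f: Vector_Spaces.linear smul "(*)" f by (rule assms)
  show "f (u + v) = f u + f v" "f (c *\<^sub>k u) = c * f u" "f 0 = 0"
    "f (u - v) = f u - f v" "f (sum g A) = (\<Sum>i\<in>A. f (g i))"
    by (auto simp: f.add f.scale f.diff f.sum)
qed

lemma lin_bilin_left: "bilin F \<Longrightarrow> lin f \<Longrightarrow> lin (\<lambda>u. F (f u) v)"
  by (auto simp: bilin_def lin_iff)

lemma lin_bilin_right: "bilin F \<Longrightarrow> lin f \<Longrightarrow> lin (\<lambda>u. F v (f u))"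
  by (auto simp: bilin_def lin_iff)

lemma bilinI: "(\<And>u. lin (F u)) \<Longrightarrow> (\<And>v. lin (\<lambda>u. F u v)) \<Longrightarrow> bilin F"
  by (simp add: bilin_def)

lemma bilin_tensor: "bilin ((\<otimes>\<^sub>k) :: ('b \<Rightarrow>\<^sub>0 'k::field) \<Rightarrow> ('c \<Rightarrow>\<^sub>0 'k) \<Rightarrow> _)"
proof (rule bilinI)
  show "lin ((\<otimes>\<^sub>k) u)" for u :: "'b \<Rightarrow>\<^sub>0 'k"
    unfolding lin_iff tensor_def lin_ext_def[of _ u]
    by (simp add: linD[OF lin_lin_ext] pm.scale_right_distrib sum.distrib pm.scale_sum_right
        mult.commute)
  show "lin (\<lambda>u. u \<otimes>\<^sub>k v)" for v :: "'c \<Rightarrow>\<^sub>0 'k"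
    unfolding tensor_def by (rule lin_lin_ext)
qed

lemma lin_on_tensor: "lin (on_tensor F)"
  unfolding on_tensor_def by (rule lin_lin_ext)

lemma lin_lambda_id: "lin (\<lambda>u. u)"
  by (simp add: lin_iff)

lemma lin_add: "lin f \<Longrightarrow> lin g \<Longrightarrow> lin (\<lambda>u. f u + g u)"
  by (simp add: lin_iff pm.scale_right_distrib add_ac)

lemma lin_smul: "lin f \<Longrightarrow> lin (\<lambda>u. c *\<^sub>k f u)"
  by (simp add: lin_iff pm.scale_right_distrib pm.scale_left_commute)

lemma lin_form_smul: "lin_form f \<Longrightarrow> lin (\<lambda>u. f u *\<^sub>k w)"
  by (simp add: lin_iff lin_form_iff pm.scale_left_distrib)

lemma lin_form_compose: "lin_form f \<Longrightarrow> lin g \<Longrightarrow> lin_form (\<lambda>u. f (g u))"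
  by (simp add: lin_iff lin_form_iff)

lemma lin_compose: "lin f \<Longrightarrow> lin g \<Longrightarrow> lin (\<lambda>u. f (g u))"
  by (simp add: lin_iff)

lemma lin_on_tensor_param: "(\<And>p q. lin (\<lambda>u. E u p q)) \<Longrightarrow> lin (\<lambda>u. on_tensor (E u) t)"
  unfolding lin_iff on_tensor_def lin_ext_def case_prod_beta
  by (simp add: sum.distrib pm.scale_right_distrib pm.scale_sum_right mult.commute)

lemma lin_sw_param: "(\<And>p q. lin (\<lambda>u. E u p q)) \<Longrightarrow> lin (\<lambda>u. sw \<Delta> w (E u))"
  unfolding sw_def by (rule lin_on_tensor_param)

lemma lin_sw: "lin \<Delta> \<Longrightarrow> lin f \<Longrightarrow> lin (\<lambda>u. sw \<Delta> (f u) E)"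
  unfolding sw_def by (rule lin_compose[OF lin_on_tensor], rule lin_compose)

lemmas lin_intros = bilinI lin_lambda_id lin_add lin_smul lin_form_smul
  lin_bilin_left[OF bilin_tensor] lin_bilin_right[OF bilin_tensor]
  lin_sw_param lin_sw lin_compose[OF lin_on_tensor] lin_on_tensor_param

lemmas tensor_distribs =
  linD[OF lin_bilin_left[OF bilin_tensor lin_lambda_id]]
  linD[OF lin_bilin_right[OF bilin_tensor lin_lambda_id]]

lemma tensor_single:
  "Poly_Mapping.single b (1::'k::field) \<otimes>\<^sub>k Poly_Mapping.single c 1 = Poly_Mapping.single (b, c) 1"
  by (simp add: tensor_def)

text \<open>
The pure tensors span, since the basis of a tensor product consists of pure tensors.
\<close>

lemma lin_eqI_tensor:
  assumes "lin f" "lin g" "\<And>u v. f (u \<otimes>\<^sub>k v) = g (u \<otimes>\<^sub>k v)"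
  shows "f t = g t"
proof -
  have "f (Poly_Mapping.single b 1) = g (Poly_Mapping.single b 1)" for b
    using assms(3)[of "Poly_Mapping.single (fst b) 1" "Poly_Mapping.single (snd b) 1"]
    by (simp add: tensor_single)
  then show ?thesis
    by (simp add: lin_eq_lin_ext[OF assms(1), of t] lin_eq_lin_ext[OF assms(2), of t])
qed

lemma lin_on_tensor_commute: "lin f \<Longrightarrow> f (on_tensor E t) = on_tensor (\<lambda>p q. f (E p q)) t"
  by (simp add: on_tensor_def lin_ext_def linD case_prod_beta)

lemma lin_sw_commute: "lin f \<Longrightarrow> f (sw \<Delta> u E) = sw \<Delta> u (\<lambda>p q. f (E p q))"
  unfolding sw_def by (rule lin_on_tensor_commute)

text \<open>
Applying a linear form to one tensor factor; comparing coefficients in a tensor identity is done by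
slicing it.
\<close>

definition slice_left :: "(('b \<Rightarrow>\<^sub>0 'k::field) \<Rightarrow> 'k) \<Rightarrow> ('b \<times> 'c \<Rightarrow>\<^sub>0 'k) \<Rightarrow> ('c \<Rightarrow>\<^sub>0 'k)"
  where "slice_left f = on_tensor (\<lambda>u v. f u *\<^sub>k v)"

definition slice_right :: "(('c \<Rightarrow>\<^sub>0 'k::field) \<Rightarrow> 'k) \<Rightarrow> ('b \<times> 'c \<Rightarrow>\<^sub>0 'k) \<Rightarrow> ('b \<Rightarrow>\<^sub>0 'k)"
  where "slice_right f = on_tensor (\<lambda>u v. f v *\<^sub>k u)"

lemma lin_slice_left: "lin (slice_left f)" and lin_slice_right: "lin (slice_right f)"
  by (simp_all add: slice_left_def slice_right_def lin_on_tensor)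

lemma slice_left_commute: "lin f \<Longrightarrow> f (slice_left c t) = on_tensor (\<lambda>p q. c p *\<^sub>k f q) t"
  unfolding slice_left_def by (simp add: lin_on_tensor_commute linD)

lemma slice_left_tensor: "lin_form f \<Longrightarrow> slice_left f (u \<otimes>\<^sub>k v) = f u *\<^sub>k v"
  unfolding slice_left_def
  by (rule on_tensor_tensor) (intro lin_intros; simp add: lin_form_iff lin_iff pm.scale_left_distrib)

lemma slice_right_tensor: "lin_form f \<Longrightarrow> slice_right f (u \<otimes>\<^sub>k v) = f v *\<^sub>k u"
  unfolding slice_right_def
  by (rule on_tensor_tensor) (intro lin_intros; simp add: lin_form_iff lin_iff pm.scale_left_distrib)

lemma on_tensor_id: "on_tensor (\<otimes>\<^sub>k) t = t"
  by (rule lin_eqI_tensor[OF lin_on_tensor lin_lambda_id]) (rule on_tensor_tensor[OF bilin_tensor])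

section \<open>Coproducts of the two operations\<close>

lemma sw_comult_cop:
  assumes "bilin E" shows "sw (comult_cop \<Delta>) u E = sw \<Delta> u (\<lambda>u1 u2. E u2 u1)"
  unfolding sw_def[of "comult_cop \<Delta>"] comult_cop_def lin_sw_commute[OF lin_on_tensor]
  by (simp add: on_tensor_tensor assms)

lemma lin_comult_cop: "lin \<Delta> \<Longrightarrow> lin (comult_cop \<Delta>)"
  unfolding comult_cop_def by (intro lin_intros)

lemma comult_tensor_tensor:
  assumes "lin \<Delta>" "lin \<Delta>'"
  shows "comult_tensor \<Delta> \<Delta>' (u \<otimes>\<^sub>k v) =
    sw \<Delta> u (\<lambda>u1 u2. sw \<Delta>' v (\<lambda>v1 v2. (u1 \<otimes>\<^sub>k v1) \<otimes>\<^sub>k (u2 \<otimes>\<^sub>k v2)))"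
  unfolding comult_tensor_def by (rule on_tensor_tensor) (intro lin_intros assms)

lemma sw_swap:
  "sw \<Delta> u (\<lambda>u1 u2. sw \<Delta>' v (\<lambda>v1 v2. E u1 u2 v1 v2)) =
   sw \<Delta>' v (\<lambda>v1 v2. sw \<Delta> u (\<lambda>u1 u2. E u1 u2 v1 v2))"
  unfolding sw_def on_tensor_def lin_ext_def case_prod_beta pm.scale_sum_right
  by (subst sum.swap) (simp add: mult.commute)

context coalgebra
begin

lemma counit_sw_left:
  assumes "lin f"
  shows "sw \<Delta> u (\<lambda>u1 u2. \<epsilon> u1 *\<^sub>k f u2) = f u"
  using lin_sw_commute[OF assms, of \<Delta> u "\<lambda>u1 u2. \<epsilon> u1 *\<^sub>k u2"]
  by (simp add: counit_left linD[OF assms])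

lemma counit_sw_right:
  assumes "lin f"
  shows "sw \<Delta> u (\<lambda>u1 u2. \<epsilon> u2 *\<^sub>k f u1) = f u"
  using lin_sw_commute[OF assms, of \<Delta> u "\<lambda>u1 u2. \<epsilon> u2 *\<^sub>k u1"]
  by (simp add: counit_right linD[OF assms])

lemma sw_tensor: "sw \<Delta> u (\<otimes>\<^sub>k) = \<Delta> u"
  by (simp add: sw_def on_tensor_id)

lemma sw_smul: "sw \<Delta> u (\<lambda>p q. c *\<^sub>k E p q) = c *\<^sub>k sw \<Delta> u E"
  by (rule lin_sw_commute[symmetric]) (intro lin_intros)

lemma lin_counit_smul: "lin (\<lambda>u. \<epsilon> u *\<^sub>k w)"
  by (rule lin_form_smul[OF lin_counit])

text \<open>
A coalgebra map into a tensor product of coalgebras is determined by its two components, which are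
obtained by applying a counit to the other factor. These are the three instances needed: composing
each side of a coproduct with the left, with the right, or with opposite projections.
\<close>

lemma slice_counit_comult_tensor:
  shows "on_tensor (\<lambda>p q. slice_left \<epsilon> p \<otimes>\<^sub>k slice_left \<epsilon> q) (comult_tensor (comult_cop \<Delta>) \<Delta> t) =
      \<Delta> (slice_left \<epsilon> t)" (is ?L)
    and "on_tensor (\<lambda>p q. slice_right \<epsilon> q \<otimes>\<^sub>k slice_right \<epsilon> p) (comult_tensor (comult_cop \<Delta>) \<Delta> t) =
      \<Delta> (slice_right \<epsilon> t)" (is ?R)
    and "on_tensor (\<lambda>p q. slice_right \<epsilon> p \<otimes>\<^sub>k slice_left \<epsilon> q) (comult_tensor (comult_cop \<Delta>) \<Delta> t) = t" (is ?M)
proof -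
  have *: "on_tensor E (comult_tensor (comult_cop \<Delta>) \<Delta> (u \<otimes>\<^sub>k v)) =
      sw \<Delta> u (\<lambda>u1 u2. sw \<Delta> v (\<lambda>v1 v2. E (u2 \<otimes>\<^sub>k v1) (u1 \<otimes>\<^sub>k v2)))"
    if "bilin E" for E :: "('b \<times> 'b \<Rightarrow>\<^sub>0 'k) \<Rightarrow> _ \<Rightarrow> ('c \<Rightarrow>\<^sub>0 'k)" and u v
  proof -
    have "bilin (\<lambda>u1 u2. sw \<Delta> v (\<lambda>v1 v2. E (u1 \<otimes>\<^sub>k v1) (u2 \<otimes>\<^sub>k v2)))"
      by (intro lin_intros lin_bilin_left[OF that] lin_bilin_right[OF that])
    then show ?thesis
      by (simp add: comult_tensor_tensor[OF lin_comult_cop lin_comult] lin_comult sw_comult_cop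
          lin_sw_commute[OF lin_on_tensor] on_tensor_tensor[OF that])
  qed
  have b: "bilin (\<lambda>p q. slice_left \<epsilon> p \<otimes>\<^sub>k slice_left \<epsilon> q)"
    "bilin (\<lambda>p q. slice_right \<epsilon> q \<otimes>\<^sub>k slice_right \<epsilon> p)"
    "bilin (\<lambda>p q. slice_right \<epsilon> p \<otimes>\<^sub>k slice_left \<epsilon> q)"
    by (intro lin_intros lin_slice_left lin_slice_right)+
  have l: "lin (\<lambda>t. on_tensor E (comult_tensor (comult_cop \<Delta>) \<Delta> t))" for E
    unfolding comult_tensor_def by (intro lin_intros)
  note simps = slice_left_tensor slice_right_tensor lin_counit tensor_distribs sw_smul
  show ?L
    by (rule lin_eqI_tensor[OF l lin_compose[OF lin_comult lin_slice_left]])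
      (simp add: *[OF b(1)] simps pm.scale_left_commute sw_tensor counit_sw_left[OF lin_counit_smul]
        linD[OF lin_comult] del: pm.scale_scale)
  show ?R
    by (rule lin_eqI_tensor[OF l lin_compose[OF lin_comult lin_slice_right]])
      (simp add: *[OF b(2)] simps sw_tensor counit_sw_left[OF lin_counit_smul]
          counit_sw_right[OF lin_counit_smul] linD[OF lin_comult] del: pm.scale_scale)
  have c: "lin (\<lambda>v. u \<otimes>\<^sub>k v)" "lin (\<lambda>u. u \<otimes>\<^sub>k v)" for u v :: "'b \<Rightarrow>\<^sub>0 'k"
    by (intro lin_intros)+
  show ?M
    by (rule lin_eqI_tensor[OF l lin_lambda_id])
      (simp add: *[OF b(3)] simps counit_sw_left c del: pm.scale_scale)
qed

end

context q_magma_coalgebra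
begin

lemmas lin_op_intros = lin_intros lin_bilin_left[OF bilin_dot] lin_bilin_right[OF bilin_dot]
  lin_bilin_left[OF bilin_colon] lin_bilin_right[OF bilin_colon] lin_compose[OF lin_comult] lin_comult

text \<open>
The map that the q-magma axiom requires to be a coalgebra morphism; its components are the two
operations.
\<close>

definition braid where
  "braid = on_tensor (\<lambda>u v. sw \<Delta> u (\<lambda>u1 u2. sw \<Delta> v (\<lambda>v1 v2. (v1 \<Ztypecolon> u2) \<otimes>\<^sub>k (u1 \<cdot> v2))))"

lemma lin_braid: "lin braid"
  by (simp add: braid_def lin_on_tensor)

lemma braid_tensor:
  "braid (u \<otimes>\<^sub>k v) = sw \<Delta> u (\<lambda>u1 u2. sw \<Delta> v (\<lambda>v1 v2. (v1 \<Ztypecolon> u2) \<otimes>\<^sub>k (u1 \<cdot> v2)))"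
  unfolding braid_def by (rule on_tensor_tensor) (intro lin_op_intros)

lemma slice_left_braid: "slice_left \<epsilon> (braid (u \<otimes>\<^sub>k v)) = u \<cdot> v"
proof -
  have "slice_left \<epsilon> (braid (u \<otimes>\<^sub>k v)) =
      sw \<Delta> u (\<lambda>u1 u2. sw \<Delta> v (\<lambda>v1 v2. \<epsilon> v1 *\<^sub>k (\<epsilon> u2 *\<^sub>k (u1 \<cdot> v2))))"
    by (simp add: braid_tensor lin_sw_commute[OF lin_slice_left] slice_left_tensor lin_counit counit_colon)
  also have "\<dots> = sw \<Delta> u (\<lambda>u1 u2. \<epsilon> u2 *\<^sub>k (u1 \<cdot> v))"
    by (subst counit_sw_left) (auto intro!: lin_op_intros)
  also have "\<dots> = u \<cdot> v"
    by (rule counit_sw_right) (intro lin_op_intros)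
  finally show ?thesis .
qed

lemma slice_right_braid: "slice_right \<epsilon> (braid (u \<otimes>\<^sub>k v)) = v \<Ztypecolon> u"
proof -
  have "slice_right \<epsilon> (braid (u \<otimes>\<^sub>k v)) =
      sw \<Delta> u (\<lambda>u1 u2. sw \<Delta> v (\<lambda>v1 v2. \<epsilon> v2 *\<^sub>k (\<epsilon> u1 *\<^sub>k (v1 \<Ztypecolon> u2))))"
    by (simp add: braid_tensor lin_sw_commute[OF lin_slice_right] slice_right_tensor lin_counit counit_dot mult.commute)
  also have "\<dots> = sw \<Delta> u (\<lambda>u1 u2. \<epsilon> u1 *\<^sub>k (v \<Ztypecolon> u2))"
    by (subst counit_sw_right) (auto intro!: lin_op_intros)
  also have "\<dots> = v \<Ztypecolon> u"
    by (rule counit_sw_left) (intro lin_op_intros)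
  finally show ?thesis .
qed

lemma comult_braid:
  assumes "bilin E"
  shows "on_tensor E (comult_tensor (comult_cop \<Delta>) \<Delta> (braid (u \<otimes>\<^sub>k v))) =
    sw \<Delta> u (\<lambda>u1 u2. sw \<Delta> v (\<lambda>v1 v2. E (braid (u1 \<otimes>\<^sub>k v2)) (braid (u2 \<otimes>\<^sub>k v1))))"
proof -
  have b: "bilin (\<lambda>v1 v2. (u1 \<otimes>\<^sub>k v1) \<otimes>\<^sub>k (u2 \<otimes>\<^sub>k v2))" for u1 u2 :: "'b \<Rightarrow>\<^sub>0 'k"
    by (intro lin_intros)
  have b': "bilin (\<lambda>p q. braid p \<otimes>\<^sub>k braid q)"
    by (intro lin_intros lin_braid)
  have "comult_tensor (comult_cop \<Delta>) \<Delta> (braid t) =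
      on_tensor (\<lambda>p q. braid p \<otimes>\<^sub>k braid q) (comult_tensor \<Delta> (comult_cop \<Delta>) t)" for t
    using q_magma_morphism unfolding coalgebra_morphism_def braid_def[symmetric]
    by (simp add: sw_def)
  then show ?thesis
    by (simp add: comult_tensor_tensor[OF lin_comult lin_comult_cop] lin_comult sw_comult_cop[OF b]
      lin_sw_commute[OF lin_on_tensor] on_tensor_tensor[OF b'] on_tensor_tensor[OF assms])
qed

text \<open>
Projecting the morphism property of the braiding to its second component on both sides.
\<close>

lemma comult_dot: "\<Delta> (u \<cdot> v) = sw \<Delta> u (\<lambda>u1 u2. sw \<Delta> v (\<lambda>v1 v2. (u1 \<cdot> v2) \<otimes>\<^sub>k (u2 \<cdot> v1)))"
  using comult_braid[of "\<lambda>p q. slice_left \<epsilon> p \<otimes>\<^sub>k slice_left \<epsilon> q" u v]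
  by (simp add: slice_counit_comult_tensor slice_left_braid lin_intros lin_slice_left)

lemma comult_colon: "\<Delta> (v \<Ztypecolon> u) = sw \<Delta> v (\<lambda>v1 v2. sw \<Delta> u (\<lambda>u1 u2. (v1 \<Ztypecolon> u2) \<otimes>\<^sub>k (v2 \<Ztypecolon> u1)))"
  using comult_braid[of "\<lambda>p q. slice_right \<epsilon> q \<otimes>\<^sub>k slice_right \<epsilon> p" u v]
  by (simp add: slice_counit_comult_tensor slice_right_braid lin_intros lin_slice_right sw_swap[of _ v])

text \<open>
The mixed projection of the morphism property: the two components of a coalgebra map into a tensor
product cocommute.
\<close>

lemma dot_colon_compat:
  "sw \<Delta> u (\<lambda>u1 u2. sw \<Delta> v (\<lambda>v1 v2. (v1 \<Ztypecolon> u2) \<otimes>\<^sub>k (u1 \<cdot> v2))) =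
   sw \<Delta> u (\<lambda>u1 u2. sw \<Delta> v (\<lambda>v1 v2. (v2 \<Ztypecolon> u1) \<otimes>\<^sub>k (u2 \<cdot> v1)))"
  using comult_braid[of "\<lambda>p q. slice_right \<epsilon> p \<otimes>\<^sub>k slice_left \<epsilon> q" u v]
  by (simp add: slice_counit_comult_tensor slice_left_braid slice_right_braid lin_intros lin_slice_left
      lin_slice_right) (simp add: braid_tensor)

end

section \<open>The monomial basis\<close>

lemma lin_lin_ext_commute: "lin f \<Longrightarrow> f (lin_ext E t) = lin_ext (\<lambda>b. f (E b)) t"
  by (simp add: lin_ext_def linD)

lemma lin_eqI_keys:
  assumes "lin f" "lin g" "Poly_Mapping.keys v \<subseteq> B"
    "\<And>b. b \<in> B \<Longrightarrow> f (Poly_Mapping.single b 1) = g (Poly_Mapping.single b 1)"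
  shows "f v = g v"
proof -
  have "f (Poly_Mapping.single b 1) = g (Poly_Mapping.single b 1)" if "b \<in> Poly_Mapping.keys v" for b
    using assms(3,4) that by blast
  then show ?thesis
    by (simp add: lin_eq_lin_ext[OF assms(1), of v] lin_eq_lin_ext[OF assms(2), of v] lin_ext_def)
qed

lemma keys_single_one: "Poly_Mapping.keys (Poly_Mapping.single b (1::'k::field)) = {b}"
  by simp

lemma keys_lin_ext_subset:
  assumes "\<And>b. b \<in> Poly_Mapping.keys v \<Longrightarrow> Poly_Mapping.keys (E b) \<subseteq> B"
  shows "Poly_Mapping.keys (lin_ext E v) \<subseteq> B"
proof -
  have "c \<in> B" if "Poly_Mapping.lookup (lin_ext E v) c \<noteq> 0" for c
  proof -
    from that obtain b where "b \<in> Poly_Mapping.keys v" "Poly_Mapping.lookup (E b) c \<noteq> 0"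
      by (auto simp: lin_ext_def lookup_sum elim!: sum.not_neutral_contains_not_neutral)
    then show ?thesis using assms by (metis in_keys_iff subsetD)
  qed
  then show ?thesis by (auto simp: in_keys_iff)
qed

lemma keys_smul_subset: "Poly_Mapping.keys (c *\<^sub>k v) \<subseteq> Poly_Mapping.keys v"
  by (auto simp: in_keys_iff)

context rank_one_datum
begin

abbreviation N :: nat where "N \<equiv> char_order \<chi> a"

lemma char_mult: "g \<in> carrier G \<Longrightarrow> h \<in> carrier G \<Longrightarrow> \<chi> (g \<otimes> h) = \<chi> g * \<chi> h"
  using character by (auto simp: hom_def ring_of_type_algebra_def)

lemma char_nonzero: "g \<in> carrier G \<Longrightarrow> \<chi> g \<noteq> 0"
  using character by (auto simp: hom_def ring_of_type_algebra_def)

lemma char_one: "\<chi> \<one> = 1"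
  using char_mult[of \<one> \<one>] char_nonzero[of \<one>] by simp

lemma char_pow: "g \<in> carrier G \<Longrightarrow> \<chi> (g [^] (m::nat)) = \<chi> g ^ m"
  by (induction m) (auto simp: char_one char_mult)

lemma units_pow: "(c :: 'k) [^]\<^bsub>units_group\<^esub> (m::nat) = c ^ m"
  by (induction m) (auto simp: ring_of_type_algebra_def)

lemma char_a_pow_eq_1: "\<chi> a ^ m = 1 \<longleftrightarrow> N dvd m"
proof -
  interpret K: field "ring_of_type_algebra :: 'k ring" by (rule field_from_type_algebra)
  have "units_group = units_of (ring_of_type_algebra :: 'k ring)"
    by (simp add: Ring_Divisibility.mult_of_def Multiplicative_Group.mult_of_def units_of_def K.field_Units)
  then interpret U: group "units_group :: 'k monoid" using K.units_group by simp
  have "\<chi> a \<in> carrier units_group"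
    using character a_closed by (auto simp: hom_def)
  from U.pow_eq_id[OF this, of m] show ?thesis
    by (simp add: char_order_def units_pow) (simp add: ring_of_type_algebra_def)
qed

lemma char_a_neq_1: "\<chi> a \<noteq> 1"
  using char_a_pow_eq_1[of 1] order_gt_1 by auto

lemma a_neq_one: "a \<noteq> \<one>"
  using char_a_neq_1 char_one by auto

lemma mult_a_neq: "g \<in> carrier G \<Longrightarrow> g \<otimes> a \<noteq> g"
  using a_neq_one a_closed by simp

text \<open>
The free algebra acts on the space with basis \<open>(g, m)\<close>, where \<open>(g, m)\<close> stands for \<open>g x\<^sup>m\<close>, by the
formulas for left multiplication that the relations suggest. Checking that all relations act as
zero proves the monomials linearly independent. Both conditions \<open>g \<in> carrier G\<close> and \<open>m < N\<close> have
to be carried along, because the relations fail on the other basis vectors.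
\<close>

definition letter_act :: "'g letter \<Rightarrow> ('g \<times> nat \<Rightarrow>\<^sub>0 'k) \<Rightarrow> ('g \<times> nat \<Rightarrow>\<^sub>0 'k)"
  where "letter_act s = (case s of
    Grp h \<Rightarrow> lin_ext (\<lambda>(g, m). Poly_Mapping.single (h \<otimes> g, m) 1)
  | Var \<Rightarrow> lin_ext (\<lambda>(g, m). if Suc m < N then \<chi> g *\<^sub>k Poly_Mapping.single (g, Suc m) 1
      else (\<chi> g * \<alpha>) *\<^sub>k (Poly_Mapping.single (g \<otimes> a [^] N, 0) 1 - Poly_Mapping.single (g, 0) 1)))"

definition free_act :: "('g letter list \<Rightarrow>\<^sub>0 'k) \<Rightarrow> ('g \<times> nat \<Rightarrow>\<^sub>0 'k) \<Rightarrow> ('g \<times> nat \<Rightarrow>\<^sub>0 'k)"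
  where "free_act f v = lin_ext (\<lambda>w. foldr letter_act w v) f"

definition monomials :: "('g \<times> nat) set"
  where "monomials = carrier G \<times> {..<N}"

lemma finite_monomials: "finite monomials"
  by (simp add: monomials_def finite_carrier)

lemma lin_letter_act: "lin (letter_act s)"
  by (cases s) (simp_all add: letter_act_def lin_lin_ext)

lemma lin_foldr_letter_act: "lin (foldr letter_act w)"
  by (induction w) (auto simp: lin_lambda_id id_def comp_def intro: lin_compose[OF lin_letter_act])

lemma lin_letter_act_pow: "lin (letter_act s ^^ j)"
  using lin_foldr_letter_act[of "replicate j s"] by simp

lemma lin_free_act: "lin (\<lambda>f. free_act f v)"
  unfolding free_act_def by (rule lin_lin_ext)

lemma lin_free_act_right: "lin (free_act f)"
  unfolding free_act_def[abs_def] lin_ext_def lin_iff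
  by (simp add: linD[OF lin_foldr_letter_act] pm.scale_right_distrib sum.distrib pm.scale_sum_right mult.commute)

lemma free_act_word: "free_act (word w) v = foldr letter_act w v"
  by (simp add: free_act_def word_def)

lemma free_act_free_mul: "free_act (free_mul f g) v = free_act f (free_act g v)"
  unfolding free_mul_def lin_lin_ext_commute[OF lin_free_act] free_act_word
  by (simp add: free_act_def lin_lin_ext_commute[OF lin_foldr_letter_act])

lemma letter_act_Grp: "letter_act (Grp h) (Poly_Mapping.single (g, m) 1) = Poly_Mapping.single (h \<otimes> g, m) 1"
  by (simp add: letter_act_def)

lemma letter_act_Var:
  "Suc m < N \<Longrightarrow> letter_act Var (Poly_Mapping.single (g, m) 1) = \<chi> g *\<^sub>k Poly_Mapping.single (g, Suc m) 1"
  "Suc m = N \<Longrightarrow> letter_act Var (Poly_Mapping.single (g, m) 1) =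
     (\<chi> g * \<alpha>) *\<^sub>k (Poly_Mapping.single (g \<otimes> a [^] N, 0) 1 - Poly_Mapping.single (g, 0) 1)"
  by (simp_all add: letter_act_def)

lemma letter_act_closed:
  assumes "s \<in> rank_one_letters G" "Poly_Mapping.keys v \<subseteq> monomials"
  shows "Poly_Mapping.keys (letter_act s v) \<subseteq> monomials"
proof (cases s)
  case (Grp h)
  then show ?thesis using assms unfolding letter_act_def
    by (auto intro!: keys_lin_ext_subset simp: rank_one_letters_def monomials_def)
next
  case Var
  have "Poly_Mapping.keys (letter_act Var v) \<subseteq> monomials"
    unfolding letter_act_def letter.case
  proof (rule keys_lin_ext_subset, clarify)
    fix g m c k assume "(g, m) \<in> Poly_Mapping.keys v"
      and k: "(c, k) \<in> Poly_Mapping.keys (if Suc m < N then \<chi> g *\<^sub>k Poly_Mapping.single (g, Suc m) 1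
      else (\<chi> g * \<alpha>) *\<^sub>k (Poly_Mapping.single (g \<otimes> a [^] N, 0) 1 - Poly_Mapping.single (g, 0) 1))"
    then have g: "g \<in> carrier G" using assms by (auto simp: monomials_def)
    show "(c, k) \<in> monomials"
    proof (cases "Suc m < N")
      case True
      then show ?thesis using k g by (auto simp: in_keys_iff lookup_single monomials_def when_def split: if_splits)
    next
      case False
      then have "Poly_Mapping.lookup (Poly_Mapping.single (g \<otimes> a [^] N, 0::nat) 1 - Poly_Mapping.single (g, 0) (1::'k)) (c, k) \<noteq> 0"
        using k by (auto simp: in_keys_iff)
      then show ?thesis using g order_gt_1
        by (auto simp: lookup_minus lookup_single monomials_def when_def a_closed split: if_splits)
    qed
  qed
  then show ?thesis by (simp add: Var)
qed

lemma free_act_closed: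
  assumes "f \<in> free_alg (rank_one_letters G)" "Poly_Mapping.keys v \<subseteq> monomials"
  shows "Poly_Mapping.keys (free_act f v) \<subseteq> monomials"
  unfolding free_act_def
proof (rule keys_lin_ext_subset)
  fix w assume "w \<in> Poly_Mapping.keys f"
  then have "w \<in> lists (rank_one_letters G)" using assms by (auto simp: free_alg_def)
  then show "Poly_Mapping.keys (foldr letter_act w v) \<subseteq> monomials"
    by (induction w) (auto simp: assms(2) letter_act_closed)
qed

lemma letter_act_Var_pow:
  "m + j < N \<Longrightarrow> (letter_act Var ^^ j) (Poly_Mapping.single (g, m) 1) =
     \<chi> g ^ j *\<^sub>k Poly_Mapping.single (g, m + j) 1"
  by (induction j) (auto simp: linD[OF lin_letter_act] letter_act_Var(1) mult.commute)

lemma pow_comm: "g \<in> carrier G \<Longrightarrow> g \<otimes> g [^] (j::nat) = g [^] j \<otimes> g"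
  using nat_pow_Suc2[of g j] by simp

lemma letter_act_Grp_pow:
  "g \<in> carrier G \<Longrightarrow> (letter_act (Grp a) ^^ j) (Poly_Mapping.single (g, m) 1) =
     Poly_Mapping.single (a [^] j \<otimes> g, m) 1"
  by (induction j) (auto simp: letter_act_Grp pow_comm a_closed simp flip: m_assoc)

lemma a_pow_central: "g \<in> carrier G \<Longrightarrow> a [^] (j::nat) \<otimes> g = g \<otimes> a [^] j"
proof (induction j)
  case (Suc j)
  have "a [^] Suc j \<otimes> g = a [^] j \<otimes> (a \<otimes> g)" using Suc a_closed by (simp add: m_assoc)
  also have "\<dots> = a [^] j \<otimes> (g \<otimes> a)" using Suc.prems a_central by simp
  also have "\<dots> = (a [^] j \<otimes> g) \<otimes> a" using Suc.prems a_closed by (simp add: m_assoc)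
  also have "\<dots> = g \<otimes> a [^] Suc j" using Suc a_closed by (simp add: m_assoc)
  finally show ?case .
qed auto

lemma free_act_diff: "free_act (f - g) v = free_act f v - free_act g v"
  and free_act_smul: "free_act (c *\<^sub>k f) v = c *\<^sub>k free_act f v"
  by (simp_all add: linD[OF lin_free_act])

text \<open>
Multiplying \<open>n\<close> times by \<open>x\<close> passes the exponent \<open>n\<close> exactly once and collects \<open>\<chi>(g)\<close> at each step.
The total factor \<open>\<chi>(g)\<^sup>n\<close> is harmless precisely because of the compatibility condition on the datum.
\<close>

lemma letter_act_Var_pow_N:
  assumes g: "g \<in> carrier G" and m: "m < N"
  shows "(letter_act Var ^^ N) (Poly_Mapping.single (g, m) 1) =
    \<alpha> *\<^sub>k (Poly_Mapping.single (a [^] N \<otimes> g, m) 1 - Poly_Mapping.single (g, m) 1)"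
proof -
  have N: "letter_act Var ^^ N = (letter_act Var ^^ m) \<circ> letter_act Var \<circ> (letter_act Var ^^ (N - Suc m))"
  proof -
    have "letter_act Var ^^ (m + Suc (N - Suc m)) =
        (letter_act Var ^^ m) \<circ> letter_act Var \<circ> (letter_act Var ^^ (N - Suc m))"
      unfolding funpow_add funpow.simps o_assoc ..
    then show ?thesis using m by simp
  qed
  have g': "\<chi> (g \<otimes> a [^] N) = \<chi> g"
    using g a_closed char_a_pow_eq_1[of N] by (simp add: char_mult char_pow)
  have "(letter_act Var ^^ N) (Poly_Mapping.single (g, m) 1) =
      (\<chi> g ^ (N - Suc m) * (\<chi> g * \<alpha>) * \<chi> g ^ m) *\<^sub>k
        (Poly_Mapping.single (g \<otimes> a [^] N, m) 1 - Poly_Mapping.single (g, m) 1)"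
    using m by (subst N) (simp add: letter_act_Var_pow linD[OF lin_letter_act]
        letter_act_Var(2) linD[OF lin_letter_act_pow] g' pm.scale_right_diff_distrib mult_ac)
  also have "\<chi> g ^ (N - Suc m) * (\<chi> g * \<alpha>) * \<chi> g ^ m = \<alpha> * \<chi> g ^ N"
  proof -
    have "\<chi> g ^ N = \<chi> g ^ (N - Suc m) * \<chi> g * \<chi> g ^ m"
    proof -
      have "N = (N - Suc m) + 1 + m" using m by simp
      then show ?thesis by (metis power_add power_one_right)
    qed
    then show ?thesis by (simp add: mult_ac)
  qed
  also have "(\<alpha> * \<chi> g ^ N) *\<^sub>k (Poly_Mapping.single (g \<otimes> a [^] N, m) 1 - Poly_Mapping.single (g, m) (1::'k)) =
     \<alpha> *\<^sub>k (Poly_Mapping.single (g \<otimes> a [^] N, m) 1 - Poly_Mapping.single (g, m) 1)"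
  proof (cases "\<chi> g ^ N = 1")
    case False
    then have "\<alpha> *\<^sub>k (Poly_Mapping.single (a [^] N) 1 - Poly_Mapping.single \<one> (1::'k)) = 0" using compat g by auto
    then have "\<alpha> = 0 \<or> Poly_Mapping.single (a [^] N) 1 = Poly_Mapping.single \<one> (1::'k)" by simp
    then have "\<alpha> = 0 \<or> a [^] N = \<one>"
      by (metis keys_single_one singleton_inject)
    then show ?thesis using g by auto
  qed simp
  finally show ?thesis by (simp add: a_pow_central g)
qed

lemma free_act_relation:
  assumes r: "r \<in> rank_one_relations G \<chi> a \<alpha>" and v: "Poly_Mapping.keys v \<subseteq> monomials"
  shows "free_act r v = 0"
proof (rule lin_eqI_keys[OF lin_free_act_right _ v])
  show "lin (\<lambda>v. 0)" by (simp add: lin_iff)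
  fix b assume "b \<in> monomials"
  then obtain h m where b: "b = (h, m)" and h: "h \<in> carrier G" and m: "m < N"
    by (auto simp: monomials_def)
  consider (1) g g' where "r = word [Grp g, Grp g'] - word [Grp (g \<otimes> g')]" "g \<in> carrier G" "g' \<in> carrier G"
    | (2) "r = word [Grp \<one>] - word []"
    | (3) "r = word (replicate N Var) - \<alpha> *\<^sub>k (word (replicate N (Grp a)) - word [])"
    | (4) g where "r = word [Var, Grp g] - \<chi> g *\<^sub>k word [Grp g, Var]" "g \<in> carrier G"
    using r unfolding rank_one_relations_def by blast
  then show "free_act r (Poly_Mapping.single b 1) = 0"
  proof cases
    case 1
    then show ?thesis using h by (simp add: b free_act_diff free_act_word letter_act_Grp m_assoc)
  next
    case 2
    then show ?thesis using h by (simp add: b free_act_diff free_act_word letter_act_Grp)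
  next
    case 3
    then show ?thesis using h m
      by (simp add: b free_act_diff free_act_smul free_act_word letter_act_Var_pow_N letter_act_Grp_pow)
  next
    case 4
    show ?thesis
    proof (cases "Suc m < N")
      case True
      then show ?thesis using 4 h
        by (simp add: b free_act_diff free_act_smul free_act_word letter_act_Grp letter_act_Var(1) char_mult linD[OF lin_letter_act])
    next
      case False
      then have "Suc m = N" using m by simp
      then show ?thesis using 4 h a_closed
        by (simp add: b free_act_diff free_act_smul free_act_word letter_act_Grp letter_act_Var(2) char_mult linD[OF lin_letter_act] m_assoc mult_ac)
    qed
  qed
qed

end

lemma free_alg_diff: "f \<in> free_alg A \<Longrightarrow> g \<in> free_alg A \<Longrightarrow> f - g \<in> free_alg A"
  using keys_diff[of f g] by (auto simp: free_alg_def)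

lemma free_alg_add: "f \<in> free_alg A \<Longrightarrow> g \<in> free_alg A \<Longrightarrow> f + g \<in> free_alg A"
  using Poly_Mapping.keys_add[of f g] by (auto simp: free_alg_def)

lemma free_alg_smul: "f \<in> free_alg A \<Longrightarrow> c *\<^sub>k f \<in> free_alg A"
  using keys_smul_subset[of c f] by (auto simp: free_alg_def)

lemma word_free_alg: "w \<in> lists A \<Longrightarrow> word w \<in> free_alg A"
  by (simp add: free_alg_def word_def)

lemma lin_free_eval: "lin (free_eval mul unit \<phi>)"
  unfolding free_eval_def by (rule lin_lin_ext)

lemma free_eval_word: "free_eval mul unit \<phi> (word w) = foldr (\<lambda>s. mul (\<phi> s)) w unit"
  by (simp add: free_eval_def word_def)

lemma free_mul_Nil: "free_mul (word []) f = f" "free_mul f (word []) = f"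
  using lin_eq_lin_ext[OF lin_lambda_id, of f]
  by (simp_all add: free_mul_def word_def)

context rank_one_hopf_algebra
begin

abbreviation "letters \<equiv> rank_one_letters G"
abbreviation "eval_free \<equiv> free_eval (\<star>) unit (case_letter \<iota> x)"

lemma eval_free_relation:
  assumes "r \<in> rank_one_relations G \<chi> a \<alpha>"
  shows "eval_free r = 0"
proof -
  have "r = free_mul (word []) (free_mul r (word []))" by (simp add: free_mul_Nil)
  moreover have "word [] \<in> free_alg letters" by (rule word_free_alg) auto
  ultimately have "r \<in> free_ideal letters (rank_one_relations G \<chi> a \<alpha>)"
    unfolding free_ideal_def using assms by (intro pm.span_base) blast
  then show ?thesis using presentation by (auto simp: presented_by_def)
qed

lemmas lin_mul_left = lin_bilin_left[OF bilin_mul] and lin_mul_right = lin_bilin_right[OF bilin_mul]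
lemmas mul_distribs = linD[OF lin_mul_left[OF lin_lambda_id]] linD[OF lin_mul_right[OF lin_lambda_id]]

lemma iota_mult: "g \<in> carrier G \<Longrightarrow> h \<in> carrier G \<Longrightarrow> \<iota> g \<star> \<iota> h = \<iota> (g \<otimes> h)"
  and iota_one: "\<iota> \<one> = unit"
  and x_iota: "g \<in> carrier G \<Longrightarrow> x \<star> \<iota> g = \<chi> g *\<^sub>k (\<iota> g \<star> x)"
proof -
  show "\<iota> g \<star> \<iota> h = \<iota> (g \<otimes> h)" if "g \<in> carrier G" "h \<in> carrier G"
    using eval_free_relation[of "word [Grp g, Grp h] - word [Grp (g \<otimes> h)]"] that
    by (auto simp: rank_one_relations_def linD[OF lin_free_eval] free_eval_word unit_right)
  show "\<iota> \<one> = unit"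
    using eval_free_relation[of "word [Grp \<one>] - word []"]
    by (auto simp: rank_one_relations_def linD[OF lin_free_eval] free_eval_word unit_right)
  show "x \<star> \<iota> g = \<chi> g *\<^sub>k (\<iota> g \<star> x)" if "g \<in> carrier G"
    using eval_free_relation[of "word [Var, Grp g] - \<chi> g *\<^sub>k word [Grp g, Var]"] that
    by (auto simp: rank_one_relations_def linD[OF lin_free_eval] free_eval_word unit_right)
qed

definition xpow :: "nat \<Rightarrow> 'b \<Rightarrow>\<^sub>0 'k"
  where "xpow m = ((\<star>) x ^^ m) unit"

definition mon :: "'g \<Rightarrow> nat \<Rightarrow> 'b \<Rightarrow>\<^sub>0 'k"
  where "mon g m = \<iota> g \<star> xpow m"

lemma xpow_simps: "xpow 0 = unit" "xpow (Suc m) = x \<star> xpow m"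
  by (simp_all add: xpow_def)

lemma iota_pow: "g \<in> carrier G \<Longrightarrow> ((\<star>) (\<iota> g) ^^ j) unit = \<iota> (g [^] j)"
  by (induction j) (auto simp: iota_one iota_mult pow_comm)

lemma xpow_N: "xpow N = \<alpha> *\<^sub>k (\<iota> (a [^] N) - unit)"
  using eval_free_relation[of "word (replicate N Var) - \<alpha> *\<^sub>k (word (replicate N (Grp a)) - word [])"]
  by (auto simp: rank_one_relations_def linD[OF lin_free_eval] free_eval_word
     iota_pow[OF a_closed] xpow_def)

lemma mon_0: "mon g 0 = \<iota> g"
  by (simp add: mon_def xpow_simps unit_right)

lemma mon_1: "mon g (Suc 0) = \<iota> g \<star> x"
  by (simp add: mon_def xpow_simps unit_right)

lemma iota_mon: "g \<in> carrier G \<Longrightarrow> h \<in> carrier G \<Longrightarrow> \<iota> h \<star> mon g m = mon (h \<otimes> g) m"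
  by (simp add: mon_def iota_mult flip: mul_assoc)

lemma x_mon: "g \<in> carrier G \<Longrightarrow> x \<star> mon g m = \<chi> g *\<^sub>k mon g (Suc m)"
  by (simp add: mon_def x_iota mul_distribs xpow_simps mul_assoc flip: mul_assoc[of x])

lemma mon_N: "g \<in> carrier G \<Longrightarrow> mon g N = \<alpha> *\<^sub>k (mon (g \<otimes> a [^] N) 0 - mon g 0)"
  by (simp add: mon_def xpow_N mul_distribs iota_mult a_closed xpow_simps unit_right)

lemma eval_free_surj: "\<exists>f. f \<in> free_alg letters \<and> eval_free f = u"
proof -
  have "u \<in> eval_free ` free_alg letters" using presentation by (simp add: presented_by_def)
  then show ?thesis by blast
qed

text \<open>
The span of the monomials contains the unit and is stable under left multiplication by the
generators.
\<close>

lemma span_mon: "u \<in> pm.span (case_prod mon ` monomials)" (is "u \<in> ?S")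
proof -
  have base: "mon g m \<in> ?S" if "g \<in> carrier G" "m < N" for g m
    using that by (intro pm.span_base) (auto simp: monomials_def)
  have step: "case_letter \<iota> x s \<star> v \<in> ?S" if "s \<in> letters" "v \<in> ?S" for s v
    using that(2)
  proof (induction rule: pm.span_induct_alt)
    case base
    then show ?case by (simp add: mul_distribs pm.span_zero)
  next
    case (step c b y)
    then obtain g m where b: "b = mon g m" "g \<in> carrier G" "m < N" by (auto simp: monomials_def)
    have "case_letter \<iota> x s \<star> b \<in> ?S"
    proof (cases s)
      case (Grp h)
      then show ?thesis using that(1) b by (auto simp: rank_one_letters_def iota_mon intro!: base)
    next
      case Var
      show ?thesis
      proof (cases "Suc m < N")
        case True
        then show ?thesis using Var b by (auto simp: x_mon intro!: pm.span_scale base)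
      next
        case False
        then have "Suc m = N" using b by simp
        then show ?thesis using Var b order_gt_1 a_closed
          by (auto simp: x_mon mon_N intro!: pm.span_scale base pm.span_diff)
      qed
    qed
    then show ?case by (simp add: mul_distribs pm.span_add pm.span_scale step.IH)
  qed
  obtain f where f: "f \<in> free_alg letters" "eval_free f = u"
    using eval_free_surj by blast
  have "foldr (\<lambda>s. (\<star>) (case_letter \<iota> x s)) w unit \<in> ?S" if "w \<in> lists letters" for w
    using that
  proof (induction w)
    case Nil
    then show ?case using base[of \<one> 0] order_gt_1 by (simp add: mon_0 iota_one)
  qed (auto intro: step)
  then have "eval_free f \<in> ?S"
    unfolding free_eval_def lin_ext_def using f(1)
    by (intro pm.span_sum pm.span_scale) (auto simp: free_alg_def)
  then show ?thesis by (simp add: f)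
qed

text \<open>
The linear map from \<open>H\<close> to the module above that applies an element to the cyclic vector \<open>(1, 0)\<close>. It
does not depend on the chosen preimage in the free algebra since the ideal of relations acts as
zero, and it sends each monomial to the corresponding basis vector.
\<close>

definition coords :: "('b \<Rightarrow>\<^sub>0 'k) \<Rightarrow> ('g \<times> nat \<Rightarrow>\<^sub>0 'k)"
  where "coords u = free_act (SOME f. f \<in> free_alg letters \<and> eval_free f = u) (Poly_Mapping.single (\<one>, 0) 1)"

lemma coords_eval:
  assumes "f \<in> free_alg letters"
  shows "coords (eval_free f) = free_act f (Poly_Mapping.single (\<one>, 0) 1)" (is "_ = free_act f ?v")
proof -
  define f' where "f' = (SOME f'. f' \<in> free_alg letters \<and> eval_free f' = eval_free f)"
  have f': "f' \<in> free_alg letters \<and> eval_free f' = eval_free f"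
    unfolding f'_def by (rule someI[of _ f]) (simp add: assms)
  then have "f' - f \<in> free_ideal letters (rank_one_relations G \<chi> a \<alpha>)"
    using presentation assms by (auto simp: presented_by_def free_alg_diff linD[OF lin_free_eval])
  then have "free_act (f' - f) ?v = 0"
    unfolding free_ideal_def
  proof (induction rule: pm.span_induct_alt)
    case (step c b y)
    then obtain h r g where b: "b = free_mul h (free_mul r g)" "r \<in> rank_one_relations G \<chi> a \<alpha>"
        "g \<in> free_alg letters" by auto
    have "Poly_Mapping.keys ?v \<subseteq> monomials" using order_gt_1 by (auto simp: monomials_def)
    then have "free_act r (free_act g ?v) = 0"
      by (intro free_act_relation b free_act_closed)
    then show ?case using step
      by (simp add: b free_act_free_mul linD[OF lin_free_act] linD[OF lin_free_act_right])
  qed (simp add: linD[OF lin_free_act])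
  then show ?thesis by (simp add: coords_def f'_def[symmetric] linD[OF lin_free_act])
qed

lemma lin_coords: "lin coords"
  unfolding lin_iff
proof (intro conjI allI)
  fix u v c
  obtain f g where f: "f \<in> free_alg letters" "eval_free f = u" and g: "g \<in> free_alg letters" "eval_free g = v"
    using eval_free_surj by metis
  show "coords (u + v) = coords u + coords v"
    using coords_eval[of "f + g"] coords_eval[OF f(1)] coords_eval[OF g(1)] f g
    by (simp add: free_alg_add linD[OF lin_free_eval] linD[OF lin_free_act])
  show "coords (c *\<^sub>k u) = c *\<^sub>k coords u"
    using coords_eval[of "c *\<^sub>k f"] coords_eval[OF f(1)] f
    by (simp add: free_alg_smul linD[OF lin_free_eval] linD[OF lin_free_act])
qed

lemma coords_mon:
  assumes "g \<in> carrier G" "m < N"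
  shows "coords (mon g m) = Poly_Mapping.single (g, m) 1"
proof -
  have m: "0 + m < N" using assms by simp
  have "Grp g # replicate m Var \<in> lists letters"
    using assms by (auto simp: rank_one_letters_def)
  from coords_eval[OF word_free_alg[OF this]] show ?thesis
    using assms by (simp add: free_eval_word mon_def xpow_def free_act_word
        letter_act_Var_pow[OF m] char_one letter_act_Grp)
qed

definition coord :: "'g \<Rightarrow> nat \<Rightarrow> ('b \<Rightarrow>\<^sub>0 'k) \<Rightarrow> 'k"
  where "coord g m u = Poly_Mapping.lookup (coords u) (g, m)"

lemma lin_coord: "lin_form (coord g m)"
  by (simp add: lin_form_iff coord_def linD[OF lin_coords] lookup_add)

lemmas coord_simps = lin_formD[OF lin_coord]

lemma coord_mon:
  "g \<in> carrier G \<Longrightarrow> m < N \<Longrightarrow> coord h k (mon g m) = (if h = g \<and> k = m then 1 else 0)"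
  by (simp add: coord_def coords_mon lookup_single when_def eq_commute)

lemma mon_expansion: "u = (\<Sum>(g, m)\<in>monomials. coord g m u *\<^sub>k mon g m)"
  using span_mon[of u]
proof (induction rule: pm.span_induct_alt)
  case (step c b y)
  then obtain h k where b: "b = mon h k" "h \<in> carrier G" "k < N" by (auto simp: monomials_def)
  have "(\<Sum>(g, m)\<in>monomials. coord g m b *\<^sub>k mon g m) =
      (\<Sum>p\<in>monomials. if p = (h, k) then mon h k else 0)"
    by (rule sum.cong) (auto simp: b coord_mon split: if_splits)
  also have "\<dots> = b" using b finite_monomials by (simp add: monomials_def)
  finally have "b = (\<Sum>(g, m)\<in>monomials. coord g m b *\<^sub>k mon g m)" ..
  moreover have "(\<Sum>(g, m)\<in>monomials. coord g m (c *\<^sub>k b + y) *\<^sub>k mon g m) =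
      c *\<^sub>k (\<Sum>(g, m)\<in>monomials. coord g m b *\<^sub>k mon g m) +
      (\<Sum>(g, m)\<in>monomials. coord g m y *\<^sub>k mon g m)"
    by (simp add: coord_simps pm.scale_left_distrib sum.distrib case_prod_beta pm.scale_sum_right)
  ultimately show ?case using step.IH by simp
qed (simp add: coord_simps)

lemma coord_eqI:
  assumes "\<And>g m. g \<in> carrier G \<Longrightarrow> m < N \<Longrightarrow> coord g m u = coord g m v"
  shows "u = v"
proof -
  have "(\<Sum>(g, m)\<in>monomials. coord g m u *\<^sub>k mon g m) = (\<Sum>(g, m)\<in>monomials. coord g m v *\<^sub>k mon g m)"
    by (rule sum.cong) (auto simp: monomials_def assms)
  then show ?thesis by (simp flip: mon_expansion)
qed

end

section \<open>Group-like and skew-primitive elements\<close>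

text \<open>
The Gaussian binomial coefficients. They are defined by recursion because the quotient of
q-factorials is not available at a root of unity \<open>q\<close>.
\<close>

fun qbinom :: "'k::field \<Rightarrow> nat \<Rightarrow> nat \<Rightarrow> 'k" where
  "qbinom q m 0 = 1"
| "qbinom q 0 (Suc i) = 0"
| "qbinom q (Suc m) (Suc i) = qbinom q m i + q ^ Suc i * qbinom q m (Suc i)"

lemma qbinom_eq_0: "m < i \<Longrightarrow> qbinom q m i = 0"
  by (induction q m i rule: qbinom.induct) auto

text \<open>
For \<open>q = \<chi>(a)\<close> the coefficient \<open>1 + q + \<dots> + q\<^bsup>m-1\<^esup>\<close> of \<open>x \<otimes> a x\<^bsup>m-1\<^esup>\<close> in \<open>\<Delta> (x\<^sup>m)\<close> therefore does not
vanish for \<open>0 < m < n\<close>; this is the only property of the coefficients used to find the skew-primitive elements.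
\<close>

lemma qbinom_one: "(q - 1) * qbinom q m (Suc 0) = q ^ m - 1"
proof (induction m)
  case (Suc m)
  have "(q - 1) * qbinom q (Suc m) (Suc 0) = (q - 1) + q * ((q - 1) * qbinom q m (Suc 0))"
    by (simp add: algebra_simps)
  then show ?case unfolding Suc by (simp add: algebra_simps)
qed simp

context rank_one_hopf_algebra
begin

lemma qbinom_char_neq_0: "0 < m \<Longrightarrow> m < N \<Longrightarrow> qbinom (\<chi> a) m (Suc 0) \<noteq> 0"
  using qbinom_one[of "\<chi> a" m] char_a_pow_eq_1[of m] by (auto dest: dvd_imp_le)

lemma sw_x: "bilin E \<Longrightarrow> sw \<Delta> x E = E x (\<iota> a) + E unit x"
  by (simp add: sw_def comult_x linD[OF lin_on_tensor] on_tensor_tensor)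

lemma sw_iota: "g \<in> carrier G \<Longrightarrow> bilin E \<Longrightarrow> sw \<Delta> (\<iota> g) E = E (\<iota> g) (\<iota> g)"
  by (simp add: sw_def comult_group on_tensor_tensor)

lemma sw_unit: "bilin E \<Longrightarrow> sw \<Delta> unit E = E unit unit"
  using sw_iota[OF one_closed] by (simp add: iota_one)

lemmas lin_mul_intros = lin_intros lin_mul_left lin_mul_right lin_compose[OF lin_comult] lin_comult

lemma lin_eq_on_mon:
  assumes "lin f" "lin h" "\<And>g m. g \<in> carrier G \<Longrightarrow> m < N \<Longrightarrow> f (mon g m) = h (mon g m)"
  shows "f u = h u"
  using span_mon[of u]
  by (induction rule: pm.span_induct_alt) (auto simp: linD[OF assms(1)] linD[OF assms(2)] assms(3) monomials_def)

lemma lin_form_eq_on_mon: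
  assumes "lin_form f" "lin_form h" "\<And>g m. g \<in> carrier G \<Longrightarrow> m < N \<Longrightarrow> f (mon g m) = h (mon g m)"
  shows "f u = h u"
  using span_mon[of u]
  by (induction rule: pm.span_induct_alt)
    (auto simp: lin_formD[OF assms(1)] lin_formD[OF assms(2)] assms(3) monomials_def)

lemma mon_Suc: "mon \<one> (Suc m) = x \<star> mon \<one> m"
  by (simp add: x_mon char_one)

lemma comult_x_mult:
  "\<Delta> (x \<star> u) = sw \<Delta> u (\<lambda>u1 u2. (x \<star> u1) \<otimes>\<^sub>k (\<iota> a \<star> u2)) + sw \<Delta> u (\<lambda>u1 u2. u1 \<otimes>\<^sub>k (x \<star> u2))"
proof -
  have "bilin (\<lambda>x1 x2. sw \<Delta> u (\<lambda>u1 u2. (x1 \<star> u1) \<otimes>\<^sub>k (x2 \<star> u2)))"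
    by (intro lin_mul_intros)
  then show ?thesis by (simp add: comult_mul sw_x unit_left)
qed

text \<open>
The q-binomial formula for the power of \<open>x \<otimes> a + 1 \<otimes> x\<close>, whose summands q-commute.
\<close>

lemma comult_mon_one:
  "\<Delta> (mon \<one> m) = (\<Sum>i\<le>m. qbinom (\<chi> a) m i *\<^sub>k (mon \<one> i \<otimes>\<^sub>k mon (a [^] i) (m - i)))"
proof (induction m)
  case 0
  show ?case by (simp add: mon_0 iota_one comult_unit)
next
  case (Suc m)
  define T where "T i = mon \<one> i \<otimes>\<^sub>k mon (a [^] i) (Suc m - i)" for i
  define q where "q = \<chi> a"
  have b: "bilin (\<lambda>u1 u2. (x \<star> u1) \<otimes>\<^sub>k (\<iota> a \<star> u2))" "bilin (\<lambda>u1 u2. u1 \<otimes>\<^sub>k (x \<star> u2))"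
    by (intro lin_mul_intros)+
  have 1: "sw \<Delta> (mon \<one> m) (\<lambda>u1 u2. (x \<star> u1) \<otimes>\<^sub>k (\<iota> a \<star> u2)) = (\<Sum>i\<le>m. qbinom q m i *\<^sub>k T (Suc i))"
    by (simp add: sw_def Suc linD[OF lin_on_tensor] on_tensor_tensor[OF b(1)] T_def mon_Suc iota_mon
        a_closed pow_comm q_def)
  have "sw \<Delta> (mon \<one> m) (\<lambda>u1 u2. u1 \<otimes>\<^sub>k (x \<star> u2)) = (\<Sum>i\<le>m. (q ^ i * qbinom q m i) *\<^sub>k T i)"
    by (simp add: sw_def Suc linD[OF lin_on_tensor] on_tensor_tensor[OF b(2)] T_def x_mon
        a_closed char_pow tensor_distribs q_def Suc_diff_le mult.commute)
  also have "\<dots> = (\<Sum>i\<le>Suc m. (q ^ i * qbinom q m i) *\<^sub>k T i)"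
    by (simp add: qbinom_eq_0)
  also have "\<dots> = T 0 + (\<Sum>i\<le>m. (q ^ Suc i * qbinom q m (Suc i)) *\<^sub>k T (Suc i))"
    by (simp add: sum.atMost_Suc_shift del: sum.atMost_Suc)
  finally have 2: "sw \<Delta> (mon \<one> m) (\<lambda>u1 u2. u1 \<otimes>\<^sub>k (x \<star> u2)) =
      T 0 + (\<Sum>i\<le>m. (q ^ Suc i * qbinom q m (Suc i)) *\<^sub>k T (Suc i))" .
  have "\<Delta> (mon \<one> (Suc m)) = T 0 + (\<Sum>i\<le>m. qbinom q (Suc m) (Suc i) *\<^sub>k T (Suc i))"
    by (simp add: mon_Suc comult_x_mult 1 2 pm.scale_left_distrib sum.distrib)
  also have "\<dots> = (\<Sum>i\<le>Suc m. qbinom q (Suc m) i *\<^sub>k T i)"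
    by (simp add: sum.atMost_Suc_shift del: sum.atMost_Suc)
  finally show ?case by (simp only: T_def q_def)
qed

lemma comult_mon:
  assumes "g \<in> carrier G"
  shows "\<Delta> (mon g m) = (\<Sum>i\<le>m. qbinom (\<chi> a) m i *\<^sub>k (mon g i \<otimes>\<^sub>k mon (g \<otimes> a [^] i) (m - i)))"
proof -
  have b: "bilin (\<lambda>u1 u2. (\<iota> g \<star> u1) \<otimes>\<^sub>k (\<iota> g \<star> u2))"
    "bilin (\<lambda>g1 g2. sw \<Delta> (mon \<one> m) (\<lambda>u1 u2. (g1 \<star> u1) \<otimes>\<^sub>k (g2 \<star> u2)))"
    by (intro lin_mul_intros)+
  have "\<Delta> (\<iota> g \<star> mon \<one> m) = sw \<Delta> (mon \<one> m) (\<lambda>u1 u2. (\<iota> g \<star> u1) \<otimes>\<^sub>k (\<iota> g \<star> u2))"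
    by (simp add: comult_mul sw_iota assms b(2))
  then show ?thesis
    using assms by (simp add: sw_def comult_mon_one linD[OF lin_on_tensor] on_tensor_tensor[OF b(1)] iota_mon a_closed)
qed

definition coord2 :: "'g \<Rightarrow> nat \<Rightarrow> 'g \<Rightarrow> nat \<Rightarrow> ('b \<times> 'b \<Rightarrow>\<^sub>0 'k) \<Rightarrow> 'k"
  where "coord2 g i h j t = coord h j (slice_left (coord g i) t)"

lemma coord2_tensor: "coord2 g i h j (u \<otimes>\<^sub>k v) = coord g i u * coord h j v"
  by (simp add: coord2_def slice_left_tensor lin_coord coord_simps)

lemma lin_coord2: "lin_form (coord2 g i h j)"
  unfolding coord2_def by (rule lin_form_compose[OF lin_coord lin_slice_left])

text \<open>
The coproduct on coefficients: each coefficient of \<open>\<Delta> u\<close> is a multiple of a single coefficient of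
\<open>u\<close>. This turns equations between tensors into scalar ones.
\<close>

lemma coord2_comult:
  assumes "g \<in> carrier G" "h \<in> carrier G"
  shows "coord2 g i h j (\<Delta> u) =
    (if h = g \<otimes> a [^] i \<and> i + j < N then qbinom (\<chi> a) (i + j) i * coord g (i + j) u else 0)"
    (is "_ = ?R u")
proof (rule lin_form_eq_on_mon)
  show "lin_form (\<lambda>u. coord2 g i h j (\<Delta> u))" by (rule lin_form_compose[OF lin_coord2 lin_comult])
  show "lin_form ?R"
    by (cases "h = g \<otimes> a [^] i \<and> i + j < N") (auto simp: lin_form_iff coord_simps algebra_simps)
  fix g' m assume g': "g' \<in> carrier G" and m: "m < N"
  have "coord2 g i h j (\<Delta> (mon g' m)) =
      (\<Sum>k\<le>m. qbinom (\<chi> a) m k * (coord g i (mon g' k) * coord h j (mon (g' \<otimes> a [^] k) (m - k))))"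
    by (simp add: comult_mon g' lin_formD[OF lin_coord2] coord2_tensor)
  also have "\<dots> = (\<Sum>k\<le>m. if k = i then (if g = g' \<and> h = g' \<otimes> a [^] i \<and> j = m - i then qbinom (\<chi> a) m i else 0) else 0)"
    by (rule sum.cong) (use m g' a_closed in \<open>auto simp: coord_mon\<close>)
  also have "\<dots> = ?R (mon g' m)"
    using m g' by (auto simp: coord_mon)
  finally show "coord2 g i h j (\<Delta> (mon g' m)) = ?R (mon g' m)" .
qed

lemma iota_inj: "g \<in> carrier G \<Longrightarrow> h \<in> carrier G \<Longrightarrow> \<iota> g = \<iota> h \<Longrightarrow> g = h"
  using coord_mon[of g 0 g 0] coord_mon[of h 0 g 0] order_gt_1 by (auto simp: mon_0 split: if_splits)

lemma coord_iota: "g \<in> carrier G \<Longrightarrow> coord h k (\<iota> g) = (if h = g \<and> k = 0 then 1 else 0)"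
  using coord_mon[of g 0 h k] order_gt_1 by (simp add: mon_0)

lemma coord_iota_x: "g \<in> carrier G \<Longrightarrow> coord h k (\<iota> g \<star> x) = (if h = g \<and> k = Suc 0 then 1 else 0)"
  using coord_mon[of g "Suc 0" h k] order_gt_1 by (simp add: mon_1)

lemma coord_x: "coord h k x = (if h = \<one> \<and> k = Suc 0 then 1 else 0)"
  using coord_iota_x[of \<one> h k] by (simp add: iota_one unit_left)

lemma coord_unit: "coord h k unit = (if h = \<one> \<and> k = 0 then 1 else 0)"
  using coord_iota[of \<one> h k] by (simp add: iota_one)

text \<open>
The coefficients at \<open>(g, 0), (h, m)\<close> show that only one \<open>g\<close> occurs, with constant coefficient 1.
Those at \<open>(g, 1), (g a, m - 1)\<close> then kill the terms \<open>g x\<^sup>m\<close>, as \<open>g a \<noteq> g\<close> does not occur.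
\<close>

lemma grouplike_imp_iota:
  assumes c: "\<Delta> c = c \<otimes>\<^sub>k c" and nz: "c \<noteq> 0"
  shows "\<exists>g\<in>carrier G. c = \<iota> g"
proof -
  have *: "coord g i c * coord h j c =
      (if h = g \<otimes> a [^] i \<and> i + j < N then qbinom (\<chi> a) (i + j) i * coord g (i + j) c else 0)"
    if "g \<in> carrier G" "h \<in> carrier G" for g h i j
    using coord2_comult[of g h i j c] that by (simp add: c coord2_tensor)
  have "\<exists>g\<in>carrier G. coord g 0 c \<noteq> 0"
  proof (rule ccontr)
    assume "\<not> ?thesis"
    then have "coord g m c = 0" if "g \<in> carrier G" "m < N" for g m
      using *[of g g 0 m] that by simp
    then have "c = 0" by (intro coord_eqI) (auto simp: coord_simps)
    then show False using nz by simp
  qed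
  then obtain g where g: "g \<in> carrier G" "coord g 0 c \<noteq> 0" by blast
  have 1: "coord g 0 c = 1" using *[of g g 0 0] g order_gt_1 by simp
  have 2: "coord h m c = 0" if "h \<in> carrier G" "h \<noteq> g" for h m
    using *[of g h 0 m] g that by simp
  have 3: "coord g m c = 0" if "0 < m" "m < N" for m
    using *[of g "g \<otimes> a" "Suc 0" "m - 1"] 2[of "g \<otimes> a" "m - 1"] g a_closed mult_a_neq[of g] that
      qbinom_char_neq_0[of m] by auto
  have "c = \<iota> g"
    by (rule coord_eqI) (use 1 2 3 g in \<open>auto simp: coord_iota\<close>)
  then show ?thesis using g by blast
qed

text \<open>
Again by comparing coefficients of \<open>\<Delta> c\<close>: pairs \<open>(b, 0), (b, m)\<close> leave only the terms \<open>g x\<^sup>m\<close>, \<open>g\<close>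
and \<open>h\<close>, pairs \<open>(g, 1), (g a, m - 1)\<close> exclude \<open>m \<ge> 2\<close>, and the pair \<open>(g, 1), (g a, 0)\<close> shows that
\<open>g x\<close> occurs only if \<open>h = g a\<close>.
\<close>

lemma skew_primitive:
  assumes c: "\<Delta> c = c \<otimes>\<^sub>k \<iota> h + \<iota> g \<otimes>\<^sub>k c" and g: "g \<in> carrier G" and h: "h \<in> carrier G"
  shows "c = coord g 0 c *\<^sub>k (\<iota> g - \<iota> h) + coord g (Suc 0) c *\<^sub>k (\<iota> g \<star> x)"
    and "coord g (Suc 0) c = 0 \<or> h = g \<otimes> a"
proof -
  have *: "coord b i c * coord b' j (\<iota> h) + coord b i (\<iota> g) * coord b' j c =
      (if b' = b \<otimes> a [^] i \<and> i + j < N then qbinom (\<chi> a) (i + j) i * coord b (i + j) c else 0)"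
    if "b \<in> carrier G" "b' \<in> carrier G" for b b' i j
    using coord2_comult[of b b' i j c] that by (simp add: c coord2_tensor lin_formD[OF lin_coord2])
  have 1: "coord b m c = 0" if "b \<in> carrier G" "b \<noteq> g" "0 < m" "m < N" for b m
    using *[of b b 0 m] that g h by (simp add: coord_iota)
  have 2: "coord b 0 c = 0" if "b \<in> carrier G" "b \<noteq> g" "b \<noteq> h" for b
    using *[of b b 0 0] that g h order_gt_1 by (simp add: coord_iota)
  have 3: "coord h 0 c = - coord g 0 c" if "h \<noteq> g"
    using *[of g h 0 0] that g h by (simp add: coord_iota eq_neg_iff_add_eq_0 add.commute)
  have 4: "coord g 0 c = 0" if "h = g"
  proof -
    have "coord g 0 c + coord g 0 c = coord g 0 c + 0"
      using *[of g g 0 0] that g h order_gt_1 by (simp only: coord_iota) simp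
    then show ?thesis by (simp only: add_left_cancel)
  qed
  have 5: "coord g m c = 0" if "Suc 0 < m" "m < N" for m
    using *[of g "g \<otimes> a" "Suc 0" "m - 1"] g h a_closed that qbinom_char_neq_0[of m]
    by (auto simp: coord_iota)
  show "coord g (Suc 0) c = 0 \<or> h = g \<otimes> a"
    using *[of g "g \<otimes> a" "Suc 0" 0] g h a_closed order_gt_1 by (auto simp: coord_iota split: if_splits)
  show "c = coord g 0 c *\<^sub>k (\<iota> g - \<iota> h) + coord g (Suc 0) c *\<^sub>k (\<iota> g \<star> x)"
  proof (rule coord_eqI)
    fix b m assume b: "b \<in> carrier G" and m: "m < N"
    consider "m = 0" | "m = Suc 0" | "Suc 0 < m" by linarith
    then show "coord b m c = coord b m (coord g 0 c *\<^sub>k (\<iota> g - \<iota> h) + coord g (Suc 0) c *\<^sub>k (\<iota> g \<star> x))"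
      by cases (use b m g h 1[of b m] 2[of b] 3 4 5[of m] in \<open>auto simp: coord_simps coord_iota coord_iota_x\<close>)
  qed
qed

end

section \<open>Actions of a rank one Hopf algebra on itself\<close>

text \<open>
What the dot and the colon have in common, so that each argument is carried out once. The
idempotence assumption stands for the multiplication rule \<open>h k \<cdot> l = (h \<cdot> (l\<^sub>1 : k\<^sub>2)) (k\<^sub>1 \<cdot> l\<^sub>2)\<close>, which
involves both operations, at \<open>h = k = 1\<close>.
\<close>

locale rank_one_action = rank_one_hopf_algebra +
  fixes act :: "('d \<Rightarrow>\<^sub>0 'c) \<Rightarrow> ('d \<Rightarrow>\<^sub>0 'c) \<Rightarrow> ('d \<Rightarrow>\<^sub>0 'c)" (infixl "\<rhd>" 69)
  assumes bilin_act: "bilin (\<rhd>)"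
    and comult_act: "\<Delta> (u \<rhd> v) = sw \<Delta> u (\<lambda>u1 u2. sw \<Delta> v (\<lambda>v1 v2. (u1 \<rhd> v2) \<otimes>\<^sub>k (u2 \<rhd> v1)))"
    and act_unit: "u \<rhd> unit = u"
    and act_mul: "u \<rhd> v \<star> w = (u \<rhd> w) \<rhd> v"
    and unit_act_idem: "g \<in> carrier G \<Longrightarrow> (unit \<rhd> \<iota> g) \<star> (unit \<rhd> \<iota> g) = unit \<rhd> \<iota> g"
    and x_act_x_neq_0: "x \<rhd> x \<noteq> 0"
begin

lemmas lin_act_intros = lin_mul_intros lin_bilin_left[OF bilin_act] lin_bilin_right[OF bilin_act]
lemmas act_distribs = linD[OF lin_bilin_left[OF bilin_act lin_lambda_id]]
  linD[OF lin_bilin_right[OF bilin_act lin_lambda_id]]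

lemma act_iota_inv: "g \<in> carrier G \<Longrightarrow> (u \<rhd> \<iota> g) \<rhd> \<iota> (inv g) = u"
  by (simp add: iota_mult iota_one act_unit flip: act_mul)

lemma bilin_comult_act:
  "bilin (\<lambda>v1 v2. (u1 \<rhd> v2) \<otimes>\<^sub>k (u2 \<rhd> v1))"
  "bilin (\<lambda>u1 u2. (u1 \<rhd> v2) \<otimes>\<^sub>k (u2 \<rhd> v1))"
  "bilin (\<lambda>u1 u2. sw \<Delta> v (\<lambda>v1 v2. (u1 \<rhd> v2) \<otimes>\<^sub>k (u2 \<rhd> v1)))"
  "bilin (\<lambda>u1 u2. (u1 \<rhd> \<iota> a) \<otimes>\<^sub>k (u2 \<rhd> x) + (u1 \<rhd> x) \<otimes>\<^sub>k u2)"
  by (intro lin_act_intros)+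

lemmas comult_act_simps = comult_act sw_x sw_iota sw_unit bilin_comult_act act_unit

lemma iota_act_iota:
  assumes "g \<in> carrier G" "h \<in> carrier G"
  obtains k where "k \<in> carrier G" "\<iota> g \<rhd> \<iota> h = \<iota> k"
proof -
  have "\<iota> g \<noteq> 0" using coord_iota[of g g 0] assms by (auto simp: coord_simps)
  then have "\<iota> g \<rhd> \<iota> h \<noteq> 0"
    using act_iota_inv[of h "\<iota> g"] assms by (auto simp: act_distribs)
  moreover have "\<Delta> (\<iota> g \<rhd> \<iota> h) = (\<iota> g \<rhd> \<iota> h) \<otimes>\<^sub>k (\<iota> g \<rhd> \<iota> h)"
    using assms by (simp add: comult_act_simps)
  ultimately show ?thesis using grouplike_imp_iota that by blast
qed

lemma unit_act_iota:
  assumes g: "g \<in> carrier G" shows "unit \<rhd> \<iota> g = unit"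
proof -
  obtain k where k: "k \<in> carrier G" "unit \<rhd> \<iota> g = \<iota> k"
    using iota_act_iota[OF one_closed g] by (auto simp: iota_one)
  then have "\<iota> (k \<otimes> k) = \<iota> k" using unit_act_idem[OF g] by (simp add: iota_mult)
  then have "k \<otimes> k = k" using k by (intro iota_inj) auto
  then show ?thesis using k by (simp add: iota_one)
qed

text \<open>
As \<open>x \<rhd> g\<close> is skew-primitive, it has the form \<open>d (1 - a) + c x\<close>, so \<open>d\<close> is the coefficient at \<open>1\<close>.
\<close>

definition twist :: "'a \<Rightarrow> 'c" where "twist g = coord \<one> (Suc 0) (x \<rhd> \<iota> g)"
definition defect :: "'a \<Rightarrow> 'c" where "defect g = coord \<one> 0 (x \<rhd> \<iota> g)"

text \<open>
  As \<open>x \<rhd> g\<close> is skew-primitive with respect to \<open>1\<close> and \<open>a \<rhd> g\<close>, it would lie in the group algebra if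
  \<open>a \<rhd> g \<noteq> a\<close> or if its coefficient at \<open>x\<close> were zero. Since the inverse of \<open>g\<close> acts by the inverse map
  and preserves the group algebra, \<open>x\<close> would then lie there as well.
\<close>

lemma
  assumes g: "g \<in> carrier G"
  shows a_act_iota: "\<iota> a \<rhd> \<iota> g = \<iota> a"
    and x_act_iota: "x \<rhd> \<iota> g = defect g *\<^sub>k (unit - \<iota> a) + twist g *\<^sub>k x"
    and twist_neq_0: "twist g \<noteq> 0"
proof -
  obtain b where b: "b \<in> carrier G" "\<iota> a \<rhd> \<iota> g = \<iota> b" using iota_act_iota[OF a_closed g] .
  obtain b' where b': "b' \<in> carrier G" "\<iota> b \<rhd> \<iota> (inv g) = \<iota> b'" using iota_act_iota[OF b(1), of "inv g"] g by auto
  have "\<Delta> (x \<rhd> \<iota> g) = (x \<rhd> \<iota> g) \<otimes>\<^sub>k \<iota> b + \<iota> \<one> \<otimes>\<^sub>k (x \<rhd> \<iota> g)"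
    using g by (simp add: comult_act_simps b unit_act_iota iota_one)
  note sp = skew_primitive[OF this one_closed b(1), folded twist_def defect_def, unfolded iota_one unit_left]
  show t: "twist g \<noteq> 0"
  proof
    assume "twist g = 0"
    then have "x \<rhd> \<iota> g = defect g *\<^sub>k (unit - \<iota> b)" using sp by simp
    then have "x = defect g *\<^sub>k (unit - \<iota> b')"
      using act_iota_inv[OF g, of x] g by (simp add: act_distribs unit_act_iota b')
    then have "coord \<one> (Suc 0) x = coord \<one> (Suc 0) (defect g *\<^sub>k (unit - \<iota> b'))" by simp
    then show False by (simp add: coord_simps coord_x coord_unit coord_iota b')
  qed
  then have "b = a" using sp a_closed by simp
  then show "\<iota> a \<rhd> \<iota> g = \<iota> a" "x \<rhd> \<iota> g = defect g *\<^sub>k (unit - \<iota> a) + twist g *\<^sub>k x"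
    using b sp by simp_all
qed

text \<open>
Such an element is \<open>g\<close> times a primitive one, and there are none because \<open>a \<noteq> 1\<close>.
\<close>

lemma primitive_eq_0:
  assumes "\<Delta> c = c \<otimes>\<^sub>k \<iota> g + \<iota> g \<otimes>\<^sub>k c" "g \<in> carrier G"
  shows "c = 0"
  using skew_primitive[OF assms(1,2,2)] mult_a_neq[OF assms(2)] by auto

lemma unit_act_x: "unit \<rhd> x = 0"
  by (rule primitive_eq_0[of _ \<one>]) (simp_all add: comult_act_simps iota_one unit_act_iota a_closed)

lemma a_act_x: "\<iota> a \<rhd> x = 0"
  by (rule primitive_eq_0[of _ a]) (simp_all add: comult_act_simps a_act_iota a_closed)

definition square :: 'c where "square = coord \<one> 0 (x \<rhd> x)"

text \<open>
  Here \<open>x \<rhd> x = \<mu> (1 - a) + s x\<close> is skew-primitive because \<open>a \<rhd> x = 0\<close>. Acting by both sides of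
  \<open>x g = \<chi>(g) g x\<close> on \<open>x\<close> yields \<open>c\<^sub>g (x \<rhd> x) = \<chi>(g) ((x \<rhd> x) \<rhd> g)\<close>, where \<open>c\<^sub>g\<close> is the twist. Its
  coefficient at \<open>x\<close> for \<open>g = a\<close> gives \<open>s = 0\<close> as \<open>\<chi>(a) \<noteq> 1\<close>, and then its coefficient at \<open>1\<close> gives
  \<open>c\<^sub>g = \<chi>(g)\<close> as \<open>\<mu> \<noteq> 0\<close>.
\<close>

lemma
  shows x_act_x: "x \<rhd> x = square *\<^sub>k (unit - \<iota> a)"
    and twist_eq: "g \<in> carrier G \<Longrightarrow> twist g = \<chi> g"
proof -
  define s where "s = coord \<one> (Suc 0) (x \<rhd> x)"
  have "\<Delta> (x \<rhd> x) = (x \<rhd> x) \<otimes>\<^sub>k \<iota> a + \<iota> \<one> \<otimes>\<^sub>k (x \<rhd> x)"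
    by (simp add: comult_act_simps iota_one unit_act_iota a_closed a_act_x unit_act_x tensor_distribs)
  from skew_primitive(1)[OF this one_closed a_closed]
  have xx: "x \<rhd> x = square *\<^sub>k (unit - \<iota> a) + s *\<^sub>k x"
    by (simp add: square_def s_def iota_one unit_left)
  have eq: "twist g *\<^sub>k (x \<rhd> x) = \<chi> g *\<^sub>k ((x \<rhd> x) \<rhd> \<iota> g)" if g: "g \<in> carrier G" for g
  proof -
    have "(x \<rhd> \<iota> g) \<rhd> x = \<chi> g *\<^sub>k ((x \<rhd> x) \<rhd> \<iota> g)"
      using g by (simp add: x_iota act_distribs flip: act_mul)
    then show ?thesis
      using g by (simp add: x_act_iota act_distribs unit_act_x a_act_x)
  qed
  have act: "(x \<rhd> x) \<rhd> \<iota> g = square *\<^sub>k (unit - \<iota> a) + s *\<^sub>k (defect g *\<^sub>k (unit - \<iota> a) + twist g *\<^sub>k x)"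
    if "g \<in> carrier G" for g
    unfolding xx using that by (simp add: act_distribs unit_act_iota a_act_iota x_act_iota)
  have "twist a * s = \<chi> a * (s * twist a)"
    using arg_cong[OF eq[OF a_closed, unfolded act[OF a_closed], unfolded xx], of "coord \<one> (Suc 0)"]
    by (simp add: coord_simps coord_unit coord_x coord_iota a_closed)
  then have s: "s = 0" using twist_neq_0[OF a_closed] char_a_neq_1 by auto
  then show xx': "x \<rhd> x = square *\<^sub>k (unit - \<iota> a)" using xx by simp
  show "twist g = \<chi> g" if g: "g \<in> carrier G"
    using arg_cong[OF eq[OF g, unfolded act[OF g], unfolded xx'], of "coord \<one> 0"]
      x_act_x_neq_0 a_neq_one a_closed xx'
    by (auto simp: s coord_simps coord_unit coord_iota)
qed

text \<open>
The defect is a twisted cocycle on \<open>G\<close>; comparing its values at \<open>g a\<close> and \<open>a g\<close> suffices.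
\<close>

lemma defect_eq_0:
  assumes "defect a = 0" "g \<in> carrier G"
  shows "defect g = 0"
proof -
  have *: "defect (g \<otimes> h) = \<chi> h * defect g + defect h" if "g \<in> carrier G" "h \<in> carrier G" for g h
  proof -
    have "x \<rhd> \<iota> (g \<otimes> h) = (x \<rhd> \<iota> h) \<rhd> \<iota> g"
      using that by (simp add: iota_mult flip: act_mul)
    also have "\<dots> = defect h *\<^sub>k (unit - \<iota> a) + \<chi> h *\<^sub>k (defect g *\<^sub>k (unit - \<iota> a) + \<chi> g *\<^sub>k x)"
      using that by (simp add: x_act_iota twist_eq act_distribs unit_act_iota a_act_iota)
    finally show ?thesis using a_neq_one a_closed unfolding defect_def
      by (simp add: coord_simps coord_unit coord_iota coord_x flip: defect_def)
  qed
  have "\<chi> a * defect g = defect g"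
    using *[of g a] *[of a g] assms a_central a_closed by simp
  then show ?thesis using char_a_neq_1 by simp
qed

lemma comult_iota_x: "g \<in> carrier G \<Longrightarrow>
    \<Delta> (\<iota> g \<star> x) = \<iota> g \<otimes>\<^sub>k (\<iota> g \<star> x) + (\<iota> g \<star> x) \<otimes>\<^sub>k \<iota> (g \<otimes> a)"
  using comult_mon[of g "Suc 0"] by (simp add: mon_1 mon_0 a_closed)

text \<open>
Only the coefficient of \<open>g\<close> in the first tensor factor of the triviality condition is needed. The
slice \<open>P\<close> is the part of \<open>u\<close> supported on \<open>g\<close> and \<open>g x\<close>, which is why \<open>n = 2\<close> is assumed.
\<close>

lemma trivial_action_support:
  assumes N: "N = 2" and g: "g \<in> carrier G"
    and triv: "\<And>v. sw \<Delta> u (\<lambda>u1 u'. sw \<Delta> u' (\<lambda>u2 u3. u1 \<otimes>\<^sub>k (v \<rhd> u2) \<otimes>\<^sub>k u3)) = sw \<Delta> u (\<lambda>u1 u2. u1 \<otimes>\<^sub>k v \<otimes>\<^sub>k u2)"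
  shows "coord g (Suc 0) u = 0" and "coord g 0 u \<noteq> 0 \<Longrightarrow> v \<rhd> \<iota> g = v"
proof -
  define U W where "U = coord g 0 u" and "W = coord g (Suc 0) u"
  define P where "P = slice_left (coord g 0) (\<Delta> u)"
  have P: "P = U *\<^sub>k \<iota> g + W *\<^sub>k (\<iota> g \<star> x)"
  proof (rule coord_eqI)
    fix h j assume h: "h \<in> carrier G" "j < N"
    have "coord h j P = coord2 g 0 h j (\<Delta> u)" by (simp add: P_def coord2_def)
    also have "\<dots> = (if h = g then coord g j u else 0)" using h g by (simp add: coord2_comult)
    finally show "coord h j P = coord h j (U *\<^sub>k \<iota> g + W *\<^sub>k (\<iota> g \<star> x))"
      using h g N by (auto simp: coord_simps coord_iota coord_iota_x U_def W_def less_2_cases_iff)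
  qed
  have bE: "bilin (\<lambda>p q. (v \<rhd> p) \<otimes>\<^sub>k q)" for v by (intro lin_act_intros)
  have main: "U *\<^sub>k ((v \<rhd> \<iota> g) \<otimes>\<^sub>k \<iota> g) + W *\<^sub>k ((v \<rhd> \<iota> g) \<otimes>\<^sub>k (\<iota> g \<star> x) + (v \<rhd> \<iota> g \<star> x) \<otimes>\<^sub>k \<iota> (g \<otimes> a)) =
      v \<otimes>\<^sub>k P" for v
  proof -
    have l: "lin (\<lambda>u'. sw \<Delta> u' (\<lambda>u2 u3. (v \<rhd> u2) \<otimes>\<^sub>k u3))" by (intro lin_act_intros)
    have l': "lin (\<lambda>t. p \<otimes>\<^sub>k t)" for p :: "'d \<Rightarrow>\<^sub>0 'c" by (intro lin_intros)
    have "slice_left (coord g 0) (sw \<Delta> u (\<lambda>u1 u'. sw \<Delta> u' (\<lambda>u2 u3. u1 \<otimes>\<^sub>k (v \<rhd> u2) \<otimes>\<^sub>k u3))) =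
        sw \<Delta> u (\<lambda>u1 u'. coord g 0 u1 *\<^sub>k sw \<Delta> u' (\<lambda>u2 u3. (v \<rhd> u2) \<otimes>\<^sub>k u3))"
      by (simp add: lin_sw_commute[OF lin_slice_left] slice_left_tensor lin_coord sw_smul)
    also have "\<dots> = sw \<Delta> P (\<lambda>u2 u3. (v \<rhd> u2) \<otimes>\<^sub>k u3)"
      by (simp add: P_def slice_left_commute[OF l] sw_def[of \<Delta> u])
    also have "\<dots> = U *\<^sub>k sw \<Delta> (\<iota> g) (\<lambda>u2 u3. (v \<rhd> u2) \<otimes>\<^sub>k u3) + W *\<^sub>k sw \<Delta> (\<iota> g \<star> x) (\<lambda>u2 u3. (v \<rhd> u2) \<otimes>\<^sub>k u3)"
      unfolding P by (simp add: linD[OF l])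
    also have "\<dots> = U *\<^sub>k ((v \<rhd> \<iota> g) \<otimes>\<^sub>k \<iota> g) + W *\<^sub>k ((v \<rhd> \<iota> g) \<otimes>\<^sub>k (\<iota> g \<star> x) + (v \<rhd> \<iota> g \<star> x) \<otimes>\<^sub>k \<iota> (g \<otimes> a))"
      using g by (simp add: sw_iota bE) (simp add: sw_def comult_iota_x linD[OF lin_on_tensor] on_tensor_tensor[OF bE])
    finally have 1: "slice_left (coord g 0) (sw \<Delta> u (\<lambda>u1 u'. sw \<Delta> u' (\<lambda>u2 u3. u1 \<otimes>\<^sub>k (v \<rhd> u2) \<otimes>\<^sub>k u3))) = \<dots>" .
    have "slice_left (coord g 0) (sw \<Delta> u (\<lambda>u1 u2. u1 \<otimes>\<^sub>k v \<otimes>\<^sub>k u2)) = v \<otimes>\<^sub>k P"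
      by (simp add: lin_on_tensor_commute[OF lin_slice_left] slice_left_tensor lin_coord P_def
         slice_left_commute[OF l'] sw_def)
    then show ?thesis using 1 triv by simp
  qed
  have ga: "g \<otimes> a \<in> carrier G" "g \<otimes> a \<noteq> g" using g a_closed mult_a_neq by auto
  note sl = linD[OF lin_slice_right] slice_right_tensor[OF lin_coord]
  \<comment> \<open>Of the three terms on the left, only the last one has a component at \<open>g a\<close> in the second factor; the right side has none.\<close>
  have W0: "W *\<^sub>k (v \<rhd> \<iota> g \<star> x) = 0" for v
    using arg_cong[OF main[of v], of "slice_right (coord (g \<otimes> a) 0)"] g ga
    by (simp add: sl P coord_simps coord_iota coord_iota_x)
  have U0: "U *\<^sub>k (v \<rhd> \<iota> g) = U *\<^sub>k v" for v
    using arg_cong[OF main[of v], of "slice_right (coord g 0)"] g ga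
    by (simp add: sl P coord_simps coord_iota coord_iota_x)
  show "coord g (Suc 0) u = 0"
  proof (rule ccontr)
    assume "coord g (Suc 0) u \<noteq> 0"
    then have "(x \<rhd> x) \<rhd> \<iota> g = 0" using W0[of x] by (simp add: W_def act_mul)
    then show False using act_iota_inv[OF g, of "x \<rhd> x"] x_act_x_neq_0 by (simp add: act_distribs)
  qed
  show "v \<rhd> \<iota> g = v" if "coord g 0 u \<noteq> 0"
    using U0[of v] that by (simp add: U_def)
qed

end

section \<open>The socle\<close>

locale rank_one_q_brace = rank_one_hopf_algebra + hopf_q_brace +
  assumes dot_x_x: "dot x x \<noteq> 0" and colon_x_x: "colon x x \<noteq> 0"
begin

lemmas lin_brace_intros = lin_op_intros lin_mul_left lin_mul_right

lemma dot_unit_idem: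
  assumes "g \<in> carrier G" shows "(unit \<cdot> \<iota> g) \<star> (unit \<cdot> \<iota> g) = unit \<cdot> \<iota> g"
proof -
  have b: "bilin (\<lambda>k1 k2. (unit \<cdot> (l1 \<Ztypecolon> k2)) \<star> (k1 \<cdot> l2))"
    "bilin (\<lambda>l1 l2. (unit \<cdot> l1) \<star> (unit \<cdot> l2))" for l1 l2
    by (intro lin_brace_intros)+
  show ?thesis
    using mul_dot[of unit unit "\<iota> g"] by (simp add: sw_unit[OF b(1)] sw_iota[OF assms b(2)] unit_left colon_unit)
qed

lemma colon_unit_idem:
  assumes "g \<in> carrier G" shows "(unit \<Ztypecolon> \<iota> g) \<star> (unit \<Ztypecolon> \<iota> g) = unit \<Ztypecolon> \<iota> g"
proof -
  have b: "bilin (\<lambda>k1 k2. (unit \<Ztypecolon> (l1 \<cdot> k2)) \<star> (k1 \<Ztypecolon> l2))"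
    "bilin (\<lambda>l1 l2. (unit \<Ztypecolon> l1) \<star> (unit \<Ztypecolon> l2))" for l1 l2
    by (intro lin_brace_intros)+
  show ?thesis
    using mul_colon[of unit unit "\<iota> g"] by (simp add: sw_unit[OF b(1)] sw_iota[OF assms b(2)] unit_left dot_unit)
qed

sublocale D: rank_one_action G \<chi> a \<alpha> mul unit \<Delta> \<epsilon> S \<iota> x dot
  by unfold_locales (auto simp: bilin_dot comult_dot[symmetric] dot_unit dot_mul dot_unit_idem dot_x_x)

sublocale C: rank_one_action G \<chi> a \<alpha> mul unit \<Delta> \<epsilon> S \<iota> x colon
  by unfold_locales (auto simp: bilin_colon comult_colon[symmetric] colon_unit colon_mul colon_unit_idem colon_x_x)

text \<open>
  The compatibility of dot and colon at \<open>(x, x)\<close> determines \<open>x : a \<otimes> x \<cdot> a\<close> up to terms with a factor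
  \<open>1 - a\<close> on one side and a group element on the other. The coefficients at \<open>x \<otimes> x\<close>, \<open>x \<otimes> 1\<close> and
  \<open>1 \<otimes> x\<close> are therefore those of \<open>x \<otimes> x\<close>.
\<close>

lemma
  shows char_a_square: "\<chi> a * \<chi> a = 1"
    and dot_defect_a: "D.defect a = 0"
    and colon_defect_a: "C.defect a = 0"
proof -
  have b: "bilin (\<lambda>v1 v2. (v1 \<Ztypecolon> u2) \<otimes>\<^sub>k (u1 \<cdot> v2))" "bilin (\<lambda>v1 v2. (v2 \<Ztypecolon> u1) \<otimes>\<^sub>k (u2 \<cdot> v1))"
    "bilin (\<lambda>u1 u2. (x \<Ztypecolon> u2) \<otimes>\<^sub>k (u1 \<cdot> \<iota> a) + (unit \<Ztypecolon> u2) \<otimes>\<^sub>k (u1 \<cdot> x))"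
    "bilin (\<lambda>u1 u2. (\<iota> a \<Ztypecolon> u1) \<otimes>\<^sub>k (u2 \<cdot> x) + (x \<Ztypecolon> u1) \<otimes>\<^sub>k (u2 \<cdot> unit))" for u1 u2
    by (intro lin_brace_intros)+
  have eq: "(x \<Ztypecolon> \<iota> a) \<otimes>\<^sub>k (x \<cdot> \<iota> a) + unit \<otimes>\<^sub>k (x \<cdot> x) + (x \<Ztypecolon> x) \<otimes>\<^sub>k unit =
      (x \<Ztypecolon> x) \<otimes>\<^sub>k \<iota> a + \<iota> a \<otimes>\<^sub>k (x \<cdot> x) + x \<otimes>\<^sub>k x"
    using dot_colon_compat[of x x, unfolded sw_x[OF b(1)] sw_x[OF b(2)] sw_x[OF b(3)] sw_x[OF b(4)]]
    by (simp add: D.a_act_x C.a_act_x D.unit_act_x C.unit_act_x D.unit_act_iota C.unit_act_iota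
        a_closed dot_unit colon_unit tensor_distribs add_ac)
  note simps = lin_formD[OF lin_coord2] coord2_tensor D.x_act_iota C.x_act_iota D.twist_eq C.twist_eq
    D.x_act_x C.x_act_x coord_simps coord_unit coord_iota coord_x a_closed
  show q: "\<chi> a * \<chi> a = 1"
    using arg_cong[OF eq, of "coord2 \<one> (Suc 0) \<one> (Suc 0)"] by (simp add: simps)
  show "D.defect a = 0"
    using arg_cong[OF eq, of "coord2 \<one> (Suc 0) \<one> 0"] a_neq_one q by (auto simp add: simps)
  show "C.defect a = 0"
    using arg_cong[OF eq, of "coord2 \<one> 0 \<one> (Suc 0)"] a_neq_one q by (auto simp add: simps)
qed

lemma N_eq_2: "N = 2"
proof -
  have "N dvd 2" using char_a_square char_a_pow_eq_1[of 2] by (simp add: power2_eq_square)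
  then show ?thesis using order_gt_1 by (auto dest: dvd_imp_le)
qed

lemma x_dot_iota: "g \<in> carrier G \<Longrightarrow> x \<cdot> \<iota> g = \<chi> g *\<^sub>k x"
  and x_colon_iota: "g \<in> carrier G \<Longrightarrow> x \<Ztypecolon> \<iota> g = \<chi> g *\<^sub>k x"
  using dot_defect_a colon_defect_a
  by (simp_all add: D.x_act_iota C.x_act_iota D.twist_eq C.twist_eq D.defect_eq_0 C.defect_eq_0)

lemma x_mult_dot:
  assumes "k \<in> carrier G" "h \<in> carrier G"
  shows "(x \<star> \<iota> k) \<cdot> \<iota> h = (x \<cdot> (\<iota> h \<Ztypecolon> \<iota> k)) \<star> (\<iota> k \<cdot> \<iota> h)"
proof -
  have b: "bilin (\<lambda>k1 k2. (x \<cdot> (l1 \<Ztypecolon> k2)) \<star> (k1 \<cdot> l2))"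
    "bilin (\<lambda>l1 l2. (x \<cdot> (l1 \<Ztypecolon> \<iota> k)) \<star> (\<iota> k \<cdot> l2))" for l1 l2
    by (intro lin_brace_intros)+
  show ?thesis
    using mul_dot[of x "\<iota> k" "\<iota> h"] by (simp add: sw_iota[OF assms(1) b(1)] sw_iota[OF assms(2) b(2)])
qed

lemma x_mult_colon:
  assumes "k \<in> carrier G" "h \<in> carrier G"
  shows "(x \<star> \<iota> k) \<Ztypecolon> \<iota> h = (x \<Ztypecolon> (\<iota> h \<cdot> \<iota> k)) \<star> (\<iota> k \<Ztypecolon> \<iota> h)"
proof -
  have b: "bilin (\<lambda>k1 k2. (x \<Ztypecolon> (l1 \<cdot> k2)) \<star> (k1 \<Ztypecolon> l2))"
    "bilin (\<lambda>l1 l2. (x \<Ztypecolon> (l1 \<cdot> \<iota> k)) \<star> (\<iota> k \<Ztypecolon> l2))" for l1 l2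
    by (intro lin_brace_intros)+
  show ?thesis
    using mul_colon[of x "\<iota> k" "\<iota> h"] by (simp add: sw_iota[OF assms(1) b(1)] sw_iota[OF assms(2) b(2)])
qed

lemma cycle_1_iota:
  assumes "v \<in> carrier G" "w \<in> carrier G"
  shows "(u \<cdot> \<iota> v) \<cdot> (\<iota> w \<Ztypecolon> \<iota> v) = (u \<cdot> \<iota> w) \<cdot> (\<iota> v \<cdot> \<iota> w)"
proof -
  have b: "bilin (\<lambda>v1 v2. (u \<cdot> v1) \<cdot> (\<iota> w \<Ztypecolon> v2))" "bilin (\<lambda>w1 w2. (u \<cdot> w2) \<cdot> (\<iota> v \<cdot> w1))"
    by (intro lin_brace_intros)+
  show ?thesis using q_cycle_1[of "\<iota> v" u "\<iota> w"] assms by (simp add: sw_iota b)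
qed

lemma cycle_3_iota:
  assumes "v \<in> carrier G" "w \<in> carrier G"
  shows "(u \<Ztypecolon> \<iota> v) \<Ztypecolon> (\<iota> w \<Ztypecolon> \<iota> v) = (u \<Ztypecolon> \<iota> w) \<Ztypecolon> (\<iota> v \<cdot> \<iota> w)"
proof -
  have b: "bilin (\<lambda>v1 v2. (u \<Ztypecolon> v1) \<Ztypecolon> (\<iota> w \<Ztypecolon> v2))" "bilin (\<lambda>w1 w2. (u \<Ztypecolon> w2) \<Ztypecolon> (\<iota> v \<cdot> w1))"
    by (intro lin_brace_intros)+
  show ?thesis using q_cycle_3[of "\<iota> v" u "\<iota> w"] assms by (simp add: sw_iota b)
qed

lemma x_neq_0: "x \<noteq> 0"
  using dot_x_x by (auto simp: D.act_distribs)

text \<open>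
Writing \<open>k x\<close> as a multiple of \<open>x k\<close> makes the multiplication rule applicable with the group element
\<open>k\<close> in the second place, so that only group elements act and no coproduct of \<open>x\<close> enters.
\<close>

lemma trivial_on_group_imp_trivial:
  assumes "h \<in> carrier G" "\<chi> h = 1" and dot: "\<And>k. k \<in> carrier G \<Longrightarrow> \<iota> k \<cdot> \<iota> h = \<iota> k"
    and colon: "\<And>k. k \<in> carrier G \<Longrightarrow> \<iota> k \<Ztypecolon> \<iota> h = \<iota> k"
  shows "v \<cdot> \<iota> h = v" "v \<Ztypecolon> \<iota> h = v"
proof -
  have x_dot: "(\<iota> k \<star> x) \<cdot> \<iota> h = \<iota> k \<star> x" and x_colon: "(\<iota> k \<star> x) \<Ztypecolon> \<iota> h = \<iota> k \<star> x"
    if k: "k \<in> carrier G" for k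
  proof -
    have gx: "\<iota> k \<star> x = inverse (\<chi> k) *\<^sub>k (x \<star> \<iota> k)"
      using k char_nonzero by (simp add: x_iota)
    obtain j where j: "j \<in> carrier G" "\<iota> h \<Ztypecolon> \<iota> k = \<iota> j" using C.iota_act_iota assms(1) k by metis
    \<comment> \<open>The q-cycle identity for \<open>x\<close>, \<open>k\<close>, \<open>h\<close> reads \<open>\<chi>(k) \<chi>(h : k) = \<chi>(h) \<chi>(k)\<close> after removing \<open>x\<close>.\<close>
    have "(\<chi> k * \<chi> j) *\<^sub>k x = \<chi> k *\<^sub>k x"
      using cycle_1_iota[OF k assms(1), of x] k j assms(1,2)
      by (simp add: dot x_dot_iota D.act_distribs)
    then have "\<chi> j = 1" using x_neq_0 char_nonzero[OF k] by (simp flip: mult_cancel_left1)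
    then have "(x \<star> \<iota> k) \<cdot> \<iota> h = x \<star> \<iota> k" using j k assms(1) by (simp add: x_mult_dot x_dot_iota dot)
    then show "(\<iota> k \<star> x) \<cdot> \<iota> h = \<iota> k \<star> x" by (simp add: gx D.act_distribs)
    obtain j where j: "j \<in> carrier G" "\<iota> h \<cdot> \<iota> k = \<iota> j" using D.iota_act_iota assms(1) k by metis
    have "(\<chi> k * \<chi> j) *\<^sub>k x = \<chi> k *\<^sub>k x"
      using cycle_3_iota[OF assms(1) k, of x] k j assms(1,2)
      by (simp add: colon x_colon_iota C.act_distribs)
    then have "\<chi> j = 1" using x_neq_0 char_nonzero[OF k] by (simp flip: mult_cancel_left1)
    then have "(x \<star> \<iota> k) \<Ztypecolon> \<iota> h = x \<star> \<iota> k" using j k assms(1) by (simp add: x_mult_colon x_colon_iota colon)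
    then show "(\<iota> k \<star> x) \<Ztypecolon> \<iota> h = \<iota> k \<star> x" by (simp add: gx C.act_distribs)
  qed
  show "v \<cdot> \<iota> h = v"
    by (rule lin_eq_on_mon[OF _ lin_lambda_id])
      (auto simp: N_eq_2 less_2_cases_iff mon_0 mon_1 dot x_dot intro!: lin_brace_intros)
  show "v \<Ztypecolon> \<iota> h = v"
    by (rule lin_eq_on_mon[OF _ lin_lambda_id])
      (auto simp: N_eq_2 less_2_cases_iff mon_0 mon_1 colon x_colon intro!: lin_brace_intros)
qed

theorem hopf_socle_eq:
  "hopf_socle \<Delta> dot colon = pm.span (\<iota> ` {h \<in> group_socle G \<iota> dot colon. \<chi> h = 1})" (is "?S = pm.span (\<iota> ` ?L)")
proof
  show "pm.span (\<iota> ` ?L) \<subseteq> ?S"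
  proof (rule pm.span_minimal)
    have l: "lin (\<lambda>u. sw \<Delta> u (\<lambda>u1 u'. sw \<Delta> u' (\<lambda>u2 u3. u1 \<otimes>\<^sub>k (v \<cdot> u2) \<otimes>\<^sub>k u3)))"
       "lin (\<lambda>u. sw \<Delta> u (\<lambda>u1 u'. sw \<Delta> u' (\<lambda>u2 u3. u1 \<otimes>\<^sub>k (v \<Ztypecolon> u2) \<otimes>\<^sub>k u3)))"
       "lin (\<lambda>u. sw \<Delta> u (\<lambda>u1 u2. u1 \<otimes>\<^sub>k v \<otimes>\<^sub>k u2))" for v
      by (intro lin_brace_intros)+
    show "pm.subspace ?S"
      by (rule pm.subspaceI) (simp_all add: hopf_socle_def linD[OF l(1)] linD[OF l(2)] linD[OF l(3)])
    show "\<iota> ` ?L \<subseteq> ?S"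
    proof (rule image_subsetI)
      fix h assume "h \<in> ?L"
      then have h: "h \<in> carrier G" and triv: "v \<cdot> \<iota> h = v" "v \<Ztypecolon> \<iota> h = v" for v
        using trivial_on_group_imp_trivial[of h v] by (auto simp: group_socle_def)
      have b: "bilin (\<lambda>u1 u'. sw \<Delta> u' (\<lambda>u2 u3. u1 \<otimes>\<^sub>k (v \<cdot> u2) \<otimes>\<^sub>k u3))"
          "bilin (\<lambda>u1 u'. sw \<Delta> u' (\<lambda>u2 u3. u1 \<otimes>\<^sub>k (v \<Ztypecolon> u2) \<otimes>\<^sub>k u3))"
          "bilin (\<lambda>u1 u2. u1 \<otimes>\<^sub>k v \<otimes>\<^sub>k u2)"
          "bilin (\<lambda>u2 u3. \<iota> h \<otimes>\<^sub>k (v \<cdot> u2) \<otimes>\<^sub>k u3)"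
          "bilin (\<lambda>u2 u3. \<iota> h \<otimes>\<^sub>k (v \<Ztypecolon> u2) \<otimes>\<^sub>k u3)" for v
        by (intro lin_brace_intros)+
      show "\<iota> h \<in> ?S"
        by (simp add: hopf_socle_def sw_iota h b triv)
    qed
  qed
  show "?S \<subseteq> pm.span (\<iota> ` ?L)"
  proof
    fix u assume u: "u \<in> ?S"
    have "coord g m u *\<^sub>k mon g m \<in> pm.span (\<iota> ` ?L)" if g: "g \<in> carrier G" and m: "m < N" for g m
    proof (cases "coord g m u = 0")
      case False
      note D = D.trivial_action_support[OF N_eq_2 g, of u] and C = C.trivial_action_support[OF N_eq_2 g, of u]
      have m0: "m = 0" using D(1) u False m by (auto simp: hopf_socle_def N_eq_2 less_2_cases_iff)
      have triv: "v \<cdot> \<iota> g = v" "v \<Ztypecolon> \<iota> g = v" for v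
        using D(2)[of v] C(2)[of v] u False by (simp_all add: hopf_socle_def m0)
      have "coord \<one> (Suc 0) (x \<cdot> \<iota> g) = coord \<one> (Suc 0) x" by (simp add: triv)
      then have "\<chi> g = 1" using g by (simp add: x_dot_iota coord_simps coord_x)
      then have "g \<in> ?L" using g by (simp add: group_socle_def triv)
      then show ?thesis unfolding m0 mon_0 by (intro pm.span_scale pm.span_base imageI)
    qed (simp add: pm.span_zero)
    then have "(\<Sum>(g, m)\<in>monomials. coord g m u *\<^sub>k mon g m) \<in> pm.span (\<iota> ` ?L)"
      by (intro pm.span_sum) (auto simp: monomials_def)
    then show "u \<in> pm.span (\<iota> ` ?L)" by (simp flip: mon_expansion)
  qed
qed

end

theorem mainTheorem7:
  fixes G :: "('g, 'r) monoid_scheme"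
    and \<chi> :: "'g \<Rightarrow> 'k::{alg_closed_field, field_char_0}" and a :: 'g and \<alpha> :: 'k
    and mul :: "('b \<Rightarrow>\<^sub>0 'k) \<Rightarrow> ('b \<Rightarrow>\<^sub>0 'k) \<Rightarrow> ('b \<Rightarrow>\<^sub>0 'k)"
    and unit :: "'b \<Rightarrow>\<^sub>0 'k"
    and \<Delta> :: "('b \<Rightarrow>\<^sub>0 'k) \<Rightarrow> ('b \<times> 'b \<Rightarrow>\<^sub>0 'k)"
    and \<epsilon> :: "('b \<Rightarrow>\<^sub>0 'k) \<Rightarrow> 'k"
    and S :: "('b \<Rightarrow>\<^sub>0 'k) \<Rightarrow> ('b \<Rightarrow>\<^sub>0 'k)"
    and \<iota> :: "'g \<Rightarrow> ('b \<Rightarrow>\<^sub>0 'k)" and x :: "'b \<Rightarrow>\<^sub>0 'k"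
    and dot :: "('b \<Rightarrow>\<^sub>0 'k) \<Rightarrow> ('b \<Rightarrow>\<^sub>0 'k) \<Rightarrow> ('b \<Rightarrow>\<^sub>0 'k)"
    and colon :: "('b \<Rightarrow>\<^sub>0 'k) \<Rightarrow> ('b \<Rightarrow>\<^sub>0 'k) \<Rightarrow> ('b \<Rightarrow>\<^sub>0 'k)"
    and L :: "'g set"
  assumes "rank_one_datum G \<chi> a \<alpha>"
    and "rank_one_hopf_algebra G \<chi> a \<alpha> mul unit \<Delta> \<epsilon> S \<iota> x"
    and "hopf_q_brace mul unit \<Delta> \<epsilon> S dot colon"
    and "dot x x \<noteq> 0"
    and "colon x x \<noteq> 0"
    and "L = {h \<in> group_socle G \<iota> dot colon. \<chi> h = 1}"
  shows "hopf_socle \<Delta> dot colon = pm.span (\<iota> ` L)"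
proof -
  interpret rank_one_q_brace G \<chi> a \<alpha> mul unit \<Delta> \<epsilon> S \<iota> x dot colon
    using assms(2-5) by (simp add: rank_one_q_brace_def rank_one_q_brace_axioms_def)
  show ?thesis
    using hopf_socle_eq by (simp add: assms(6))
qed

end
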